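(* Let $(a,b)\subseteq\mathbb R$ be a bounded open interval and let $\varphi:(0,+\infty)\to[1,+\infty)$ be nondecreasing. For every nondecreasing $\eta:(0,+\infty)\to[1,+\infty)$, or more generally every $\eta:(0,+\infty)\to[1,+\infty)$, and every positive integer $k$ let $$\mathcal S_k^{\eta}((a,b)):=\left\{g\in L^1((a,b)):\ \sup_{\lambda>0}\frac{\mathcal M_k((a,b),g,\lambda)}{\eta(\lambda)}<+\infty\right\}.$$ Then the following statements hold. (1) For every integer $k\ge2$, $\ \mathcal S_k^\varphi((a,b))=\mathcal S_2^\varphi((a,b))$. (2) One has $$\mathcal S_1^\varphi((a,b))\subseteq\mathcal S_2^\varphi((a,b))\subseteq\mathcal S_1^{\widehat\varphi}((a,b)),\qquad\text{where}\quad\widehat\varphi(\lambda):=\sum_{i=0}^{\lfloor\log_2(1+\lambda)\rfloor}\varphi\left(\frac{\lambda}{2^i}\right)\quad\forall\lambda>0.$$ (3) For every $g\in L^1((a,b))$ and every measurable function $\psi:(0,+\infty)\to(0,+\infty)$, $$\int_a^bdy\int_a^b\frac{|g(y)-g(x)|}{|y-x|\,\psi(|y-x|)}\,dx\le4\int_0^{b-a}\frac{\mathcal M_1((a,b),g,1/w)}{\psi(w)}\,dw.$$ Consequently, if $g\in\mathcal S_1^\varphi((a,b))$, then $g\in W^{\psi,1}((a,b))$ whenever $$\int_0^{b-a}\frac{\varphi(1/w)}{\psi(w)}\,dw<+\infty.$$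
   Context: For $g\in L^1((a,b))$, a positive integer $k$, $\lambda>0$ and $\gamma\in C^k([a,b])$, set $$\mathcal F_k((a,b),g,\lambda,\gamma):=\frac1{\lambda^{k-1}}\int_a^b|\gamma^{(k)}(x)|\,dx+\lambda\int_a^b|\gamma(x)-g(x)|\,dx,$$ $$\mathcal M_k((a,b),g,\lambda):=\inf\{\mathcal F_k((a,b),g,\lambda,\gamma):\gamma\in C^k([a,b])\}.$$ $W^{\psi,1}((a,b))$ denotes the space of all $g\in L^1((a,b))$ such that $\int_a^bdy\int_a^b\frac{|g(y)-g(x)|}{|y-x|\psi(|y-x|)}\,dx<+\infty$. Integrals of nonnegative functions may take the value $+\infty$. *)

theory Defs
  imports "HOL-Analysis.Analysis"
begin

text \<open>
  Functions on \<open>(a,b)\<close> or \<open>[a,b]\<close> are total functions \<open>real \<Rightarrow> real\<close> whose values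
  outside the interval are irrelevant, and elements of \<open>L\<^sup>1\<close> are represented by integrable
  functions rather than by classes modulo null sets; everything below is invariant under
  changing \<open>g\<close> on a null set. Integrals of nonnegative functions are \<open>ennreal\<close>-valued.
\<close>

definition L1 :: "real \<Rightarrow> real \<Rightarrow> (real \<Rightarrow> real) set" where
  "L1 a b = {g. integrable (lebesgue_on {a<..<b}) g}"

text \<open>The derivatives are taken within \<open>[a,b]\<close>, hence are one-sided at the endpoints.\<close>

definition nth_deriv :: "real \<Rightarrow> real \<Rightarrow> nat \<Rightarrow> (real \<Rightarrow> real) \<Rightarrow> real \<Rightarrow> real" where
  "nth_deriv a b k \<gamma> = ((\<lambda>f x. vector_derivative f (at x within {a..b})) ^^ k) \<gamma>"

definition Ck :: "nat \<Rightarrow> real \<Rightarrow> real \<Rightarrow> (real \<Rightarrow> real) set" where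
  "Ck k a b = {\<gamma>. (\<forall>j<k. nth_deriv a b j \<gamma> differentiable_on {a..b}) \<and>
                   continuous_on {a..b} (nth_deriv a b k \<gamma>)}"

definition F_fun ::
    "nat \<Rightarrow> real \<Rightarrow> real \<Rightarrow> (real \<Rightarrow> real) \<Rightarrow> real \<Rightarrow> (real \<Rightarrow> real) \<Rightarrow> ennreal" where
  "F_fun k a b g lam \<gamma> =
     ennreal (1 / lam ^ (k - 1)) * (\<integral>\<^sup>+ x. ennreal \<bar>nth_deriv a b k \<gamma> x\<bar> \<partial>lebesgue_on {a<..<b})
     + ennreal lam * (\<integral>\<^sup>+ x. ennreal \<bar>\<gamma> x - g x\<bar> \<partial>lebesgue_on {a<..<b})"

definition M_fun :: "nat \<Rightarrow> real \<Rightarrow> real \<Rightarrow> (real \<Rightarrow> real) \<Rightarrow> real \<Rightarrow> ennreal" where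
  "M_fun k a b g lam = (INF \<gamma>\<in>Ck k a b. F_fun k a b g lam \<gamma>)"

definition S_class :: "nat \<Rightarrow> (real \<Rightarrow> real) \<Rightarrow> real \<Rightarrow> real \<Rightarrow> (real \<Rightarrow> real) set" where
  "S_class k \<eta> a b =
     {g \<in> L1 a b. (SUP lam\<in>{0<..}. M_fun k a b g lam / ennreal (\<eta> lam)) < \<infinity>}"

text \<open>On the diagonal \<open>x = y\<close> the integrand takes the value \<open>0\<close> by the convention \<open>x / 0 = 0\<close>;
  the diagonal does not contribute to the integral.\<close>

definition W_integral ::
    "(real \<Rightarrow> real) \<Rightarrow> real \<Rightarrow> real \<Rightarrow> (real \<Rightarrow> real) \<Rightarrow> ennreal" where
  "W_integral \<psi> a b g =
     (\<integral>\<^sup>+ y. (\<integral>\<^sup>+ x. ennreal (\<bar>g y - g x\<bar> / (\<bar>y - x\<bar> * \<psi> \<bar>y - x\<bar>)) \<partial>lebesgue_on {a<..<b})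
        \<partial>lebesgue_on {a<..<b})"

definition W_space :: "(real \<Rightarrow> real) \<Rightarrow> real \<Rightarrow> real \<Rightarrow> (real \<Rightarrow> real) set" where
  "W_space \<psi> a b = {g \<in> L1 a b. W_integral \<psi> a b g < \<infinity>}"

definition hat :: "(real \<Rightarrow> real) \<Rightarrow> real \<Rightarrow> real" where
  "hat \<phi> lam = (\<Sum>i = 0..nat \<lfloor>log 2 (1 + lam)\<rfloor>. \<phi> (lam / 2 ^ i))"

end

(* Write f for a near-optimal competitor in M_k(g, lam), so that the L^1 norms of f^(k) and f - g
   are O(lam^(k-1) phi(lam)) and O(phi(lam)/lam).

   S_k is contained in S_m for 2 <= m < k, and S_2 in S_1 with the hat weight: the competitors at
   the scales lam, lam/2, lam/4, ..., down to a scale in [1,2), are telescoped, and the m-th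
   derivative of each difference is bounded by the Landau inequality
     |u^(m)| <= C (h^(-m) |u| + h^(k-m) |u^(k)|)   (norms of L^1).
   This gives |f^(m)| <= C sum_i (lam/2^i)^(m-1) phi(lam/2^i), a geometric sum if m >= 2 and
   the hat weight if m = 1.

   S_k is contained in S_(k+1): f is replaced by 2 A_t f - A_2t f with t ~ 1/lam, where A_t f(x) is
   the average of f((1-t)x + tz) over z in (a,b). Contracting towards the points of (a,b), rather
   than translating, needs no extension of f beyond the interval. The (k+1)-st derivative costs a
   factor lam, and the error is a second difference of f, of size O(t^2 |f''|) and also O(t |f'|).

   The double integral is twice the integral over h in (0,b-a) of D(h)/(h psi(h)), where D(h) is the
   L^1 norm of g(.+h) - g, and comparing g with any C^1 function shows D(h) <= 2h M_1(g, 1/h). *)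
theory Submission
  imports Defs
begin

subsection \<open>The \<open>L\<^sup>1\<close> norm and sliding windows\<close>

text \<open>The obstacle in passing from order \<open>k\<close> to \<open>k + 1\<close> is the first
  derivative. For \<open>k \<ge> 2\<close> telescoping controls |f'| only by the hat weight, so an
  error t |f'| with t ~ 1/lam would be too large. A single average A_t f has such an error, because
  its mean displacement t ((a+b)/2 - x) vanishes only at the midpoint. In 2 A_t f - A_2t f the
  first-order terms cancel, and |f''| = O(lam phi(lam)) is available. For \<open>k = 1\<close> the
  competitor already satisfies |f'| = O(phi(lam)), so there the first-order error suffices. All
  pointwise estimates end in integrals of a derivative over a window around x. The intermediate
  points given by the mean value theorem depend on x in an uncontrolled way, whereas a window bound
  is measurable in x and can be integrated by Tonelli. The constant 4 is 2 * 2: one factor for the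
  symmetry of the double integral, one for the two approximation errors, at x and at x + h.\<close>

lemma nn_integral_window:
  fixes v :: "real \<Rightarrow> ennreal"
  assumes [measurable]: "v \<in> borel_measurable borel" and "0 \<le> \<alpha> + \<beta>"
  shows "(\<integral>\<^sup>+x. (\<integral>\<^sup>+t. v t * indicator {x - \<alpha>..x + \<beta>} t \<partial>lborel) \<partial>lborel)
    = ennreal (\<alpha> + \<beta>) * (\<integral>\<^sup>+t. v t \<partial>lborel)"
proof -
  \<comment> \<open>Exchanging the roles of \<open>x\<close> and \<open>t\<close> reflects the
    window, which keeps its length \<alpha> + \<beta>. That length is what the inner integral gives
    after Tonelli.\<close>
  have eq: "indicator {x - \<alpha>..x + \<beta>} t = (indicator {t - \<beta>..t + \<alpha>} x :: ennreal)" for x t :: real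
    by (auto simp: indicator_def)
  have "(\<integral>\<^sup>+x. (\<integral>\<^sup>+t. v t * indicator {x - \<alpha>..x + \<beta>} t \<partial>lborel) \<partial>lborel)
      = (\<integral>\<^sup>+t. (\<integral>\<^sup>+x. v t * indicator {x - \<alpha>..x + \<beta>} t \<partial>lborel) \<partial>lborel)"
    by (rule lborel_pair.Fubini')
       (simp add: case_prod_unfold indicator_def, measurable)
  also have "\<dots> = (\<integral>\<^sup>+t. v t * ennreal (\<alpha> + \<beta>) \<partial>lborel)"
  proof (rule nn_integral_cong)
    fix t
    have "(\<integral>\<^sup>+x. v t * indicator {t - \<beta>..t + \<alpha>} x \<partial>lborel) = v t * ennreal (\<alpha> + \<beta>)"
      using assms(2) by (subst nn_integral_cmult) (auto simp: algebra_simps)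
    then show "(\<integral>\<^sup>+x. v t * indicator {x - \<alpha>..x + \<beta>} t \<partial>lborel) = v t * ennreal (\<alpha> + \<beta>)"
      unfolding eq .
  qed
  also have "\<dots> = ennreal (\<alpha> + \<beta>) * (\<integral>\<^sup>+t. v t \<partial>lborel)"
    by (subst nn_integral_multc) (auto simp: mult.commute)
  finally show ?thesis .
qed

lemma nn_integral_lebesgue_on:
  fixes f :: "real \<Rightarrow> ennreal"
  assumes "S \<in> sets lebesgue"
  shows "(\<integral>\<^sup>+x. f x \<partial>lebesgue_on S) = (\<integral>\<^sup>+x. f x * indicator S x \<partial>lborel)"
  using assms by (subst nn_integral_restrict_space) (auto simp: nn_integral_completion)

lemma ex_dyadic_floor:
  fixes x :: real
  assumes "1 \<le> x"
  obtains n :: nat where "2 ^ n \<le> x" "x < 2 ^ Suc n"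
proof -
  obtain m :: nat where m: "x < 2 ^ m"
    using real_arch_pow[of 2 x] by auto
  define n where "n = (LEAST n. x < 2 ^ Suc n)"
  have "(2::real) ^ m \<le> 2 ^ Suc m" by simp
  then have "x < 2 ^ Suc m" using m by linarith
  then have n: "x < 2 ^ Suc n"
    unfolding n_def by (rule LeastI)
  moreover have "2 ^ n \<le> x"
  proof (cases n)
    case (Suc n')
    then show ?thesis
      using not_less_Least[of n' "\<lambda>n. x < 2 ^ Suc n", folded n_def] by simp
  qed (use assms in simp)
  ultimately show thesis using that by blast
qed

locale compact_interval =
  fixes a b :: real
  assumes ab: "a < b"
begin

text \<open>Real-valued, so that constants are handled by real arithmetic. The Bochner integral is 0
  on non-integrable functions, hence the \<open>L1\<close> hypotheses below.\<close>

definition norm1 :: "(real \<Rightarrow> real) \<Rightarrow> real" where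
  "norm1 u = (LINT x|lebesgue_on {a<..<b}. \<bar>u x\<bar>)"

lemma L1_iff: "g \<in> L1 a b \<longleftrightarrow> integrable (lebesgue_on {a<..<b}) g"
  by (simp add: L1_def)

lemma continuous_L1:
  assumes "continuous_on {a..b} u" shows "u \<in> L1 a b"
proof -
  have "set_integrable lebesgue {a..b} u"
    using continuous_imp_integrable_real[OF assms]
    by (simp add: set_integrable_def integrable_restrict_space)
  then have "set_integrable lebesgue {a<..<b} u"
    by (rule set_integrable_subset) auto
  then show ?thesis
    by (simp add: L1_iff set_integrable_def integrable_restrict_space)
qed

lemma norm1_nonneg: "0 \<le> norm1 u"
  unfolding norm1_def by simp

lemma norm1_cong: "(\<And>x. x \<in> {a..b} \<Longrightarrow> u x = v x) \<Longrightarrow> norm1 u = norm1 v"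
  unfolding norm1_def by (rule Bochner_Integration.integral_cong) auto

lemma nn_integral_norm1:
  "u \<in> L1 a b \<Longrightarrow> (\<integral>\<^sup>+x. ennreal \<bar>u x\<bar> \<partial>lebesgue_on {a<..<b}) = ennreal (norm1 u)"
  unfolding norm1_def L1_iff by (subst nn_integral_eq_integral) auto

text \<open>The endpoints form a null set. Functions cut off outside the closed interval live on the
  whole line, where translations, affine substitutions and Tonelli apply directly.\<close>

lemma nn_integral_Icc_norm1:
  assumes "u \<in> L1 a b"
  shows "(\<integral>\<^sup>+x. ennreal \<bar>u x\<bar> * indicator {a..b} x \<partial>lborel) = ennreal (norm1 u)"
proof -
  have "(\<integral>\<^sup>+x. ennreal \<bar>u x\<bar> * indicator {a..b} x \<partial>lborel)
      = (\<integral>\<^sup>+x. ennreal \<bar>u x\<bar> * indicator {a<..<b} x \<partial>lborel)"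
  proof (rule nn_integral_cong_AE)
    have "AE x in lborel. x \<noteq> a" "AE x in lborel. x \<noteq> b"
      by (rule AE_lborel_singleton)+
    then show "AE x in lborel. ennreal \<bar>u x\<bar> * indicator {a..b} x = ennreal \<bar>u x\<bar> * indicator {a<..<b} x"
      by eventually_elim (auto simp: indicator_def)
  qed
  then show ?thesis
    using nn_integral_norm1[OF assms] by (simp add: nn_integral_lebesgue_on)
qed

lemma L1_diff: "u \<in> L1 a b \<Longrightarrow> v \<in> L1 a b \<Longrightarrow> (\<lambda>x. u x - v x) \<in> L1 a b"
  unfolding L1_iff by auto

lemma norm1_add:
  assumes "u \<in> L1 a b" "v \<in> L1 a b"
  shows "norm1 (\<lambda>x. u x + v x) \<le> norm1 u + norm1 v"
proof -
  have "norm1 (\<lambda>x. u x + v x) \<le> (LINT x|lebesgue_on {a<..<b}. \<bar>u x\<bar> + \<bar>v x\<bar>)"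
    using assms unfolding L1_iff norm1_def by (intro integral_mono) auto
  also have "\<dots> = norm1 u + norm1 v"
    using assms unfolding L1_iff norm1_def by (intro Bochner_Integration.integral_add) auto
  finally show ?thesis .
qed

lemma norm1_diff:
  assumes "u \<in> L1 a b" "v \<in> L1 a b"
  shows "norm1 (\<lambda>x. u x - v x) \<le> norm1 u + norm1 v"
proof -
  have "norm1 (\<lambda>x. u x - v x) \<le> (LINT x|lebesgue_on {a<..<b}. \<bar>u x\<bar> + \<bar>v x\<bar>)"
    using assms unfolding L1_iff norm1_def by (intro integral_mono) auto
  also have "\<dots> = norm1 u + norm1 v"
    using assms unfolding L1_iff norm1_def by (intro Bochner_Integration.integral_add) auto
  finally show ?thesis .
qed

lemma norm1_cmult: "norm1 (\<lambda>x. c * u x) = \<bar>c\<bar> * norm1 u"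
  unfolding norm1_def by (simp add: abs_mult)

lemma norm1_minus_commute: "norm1 (\<lambda>x. u x - v x) = norm1 (\<lambda>x. v x - u x)"
  unfolding norm1_def by (simp add: abs_minus_commute)

lemma norm1_sum:
  "finite I \<Longrightarrow> (\<And>i. i \<in> I \<Longrightarrow> u i \<in> L1 a b) \<Longrightarrow> norm1 (\<lambda>x. \<Sum>i\<in>I. u i x) \<le> (\<Sum>i\<in>I. norm1 (u i))"
proof (induction rule: finite_induct)
  case empty
  then show ?case by (simp add: norm1_def)
next
  case (insert i I)
  have "(\<lambda>x. \<Sum>i\<in>I. u i x) \<in> L1 a b"
    using insert.prems unfolding L1_iff by auto
  then have "norm1 (\<lambda>x. u i x + (\<Sum>i\<in>I. u i x)) \<le> norm1 (u i) + norm1 (\<lambda>x. \<Sum>i\<in>I. u i x)"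
    using insert.prems by (intro norm1_add) auto
  then show ?case
    using insert by simp
qed

lemma borel_measurable_continuous_Icc:
  assumes "continuous_on {a..b} u"
  shows "(\<lambda>x. ennreal \<bar>u x\<bar> * indicator {a..b} x) \<in> borel_measurable borel"
proof -
  have "(\<lambda>x. indicator {a..b} x *\<^sub>R u x) \<in> borel_measurable borel"
    using assms by (intro borel_measurable_continuous_on_indicator) auto
  then have "(\<lambda>x. ennreal \<bar>indicator {a..b} x *\<^sub>R u x\<bar>) \<in> borel_measurable borel"
    by measurable
  moreover have "(\<lambda>x. ennreal \<bar>indicator {a..b} x *\<^sub>R u x\<bar>) = (\<lambda>x. ennreal \<bar>u x\<bar> * indicator {a..b} x)"
    by (auto simp: indicator_def fun_eq_iff)
  ultimately show ?thesis by metis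
qed

text \<open>After integrating the pointwise bound in \<open>x\<close> and exchanging the integrals,
  each \<open>t\<close> is counted over a window of length \<open>2 * H\<close>.\<close>

lemma norm1_le_window:
  assumes u: "continuous_on {a..b} u" and v: "continuous_on {a..b} v" and "0 \<le> H" "0 \<le> c"
    and le: "\<And>x. x \<in> {a..b} \<Longrightarrow> ennreal \<bar>u x\<bar> \<le>
      ennreal c * (\<integral>\<^sup>+t. (ennreal \<bar>v t\<bar> * indicator {a..b} t) * indicator {x - H..x + H} t \<partial>lborel)"
  shows "norm1 u \<le> c * (2 * H) * norm1 v"
proof -
  define V where "V t = ennreal \<bar>v t\<bar> * indicator {a..b} t" for t
  have [measurable]: "V \<in> borel_measurable borel"
    unfolding V_def by (rule borel_measurable_continuous_Icc[OF v])
  have "ennreal (norm1 u) = (\<integral>\<^sup>+x. ennreal \<bar>u x\<bar> * indicator {a..b} x \<partial>lborel)"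
    using nn_integral_Icc_norm1[OF continuous_L1[OF u]] by simp
  also have "\<dots> \<le> (\<integral>\<^sup>+x. ennreal c * (\<integral>\<^sup>+t. V t * indicator {x - H..x + H} t \<partial>lborel) \<partial>lborel)"
    using le by (intro nn_integral_mono) (auto simp: indicator_def V_def)
  also have "\<dots> = ennreal c * (\<integral>\<^sup>+x. (\<integral>\<^sup>+t. V t * indicator {x - H..x + H} t \<partial>lborel) \<partial>lborel)"
    by (rule nn_integral_cmult) (simp add: indicator_def, measurable)
  also have "\<dots> = ennreal c * (ennreal (H + H) * ennreal (norm1 v))"
    using \<open>0 \<le> H\<close> nn_integral_Icc_norm1[OF continuous_L1[OF v], folded V_def]
    by (subst nn_integral_window) auto
  also have "\<dots> = ennreal (c * (2 * H) * norm1 v)"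
    using \<open>0 \<le> H\<close> \<open>0 \<le> c\<close> norm1_nonneg by (simp add: ennreal_mult' mult.assoc)
  finally show ?thesis
    using \<open>0 \<le> H\<close> \<open>0 \<le> c\<close> norm1_nonneg by (subst (asm) ennreal_le_iff) auto
qed

text \<open>Fundamental theorem of calculus on the segment between \<open>p\<close> and
  \<open>q\<close>. The larger interval \<open>{l..r}\<close> makes the bound independent of the
  order and the exact position of the two points.\<close>

lemma increment_le_nn_integral:
  assumes der: "\<And>x. x \<in> {a..b} \<Longrightarrow> (f has_real_derivative f' x) (at x within {a..b})"
    and cont: "continuous_on {a..b} f'"
    and p: "p \<in> {a..b}" "p \<in> {l..r}" and q: "q \<in> {a..b}" "q \<in> {l..r}"
  shows "ennreal \<bar>f p - f q\<bar> \<le> (\<integral>\<^sup>+t. (ennreal \<bar>f' t\<bar> * indicator {a..b} t) * indicator {l..r} t \<partial>lborel)"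
proof -
  have main: "ennreal \<bar>f q - f p\<bar> \<le> (\<integral>\<^sup>+t. (ennreal \<bar>f' t\<bar> * indicator {a..b} t) * indicator {l..r} t \<partial>lborel)"
    if p: "p \<in> {a..b}" "p \<in> {l..r}" and q: "q \<in> {a..b}" "q \<in> {l..r}" and "p \<le> q" for p q
  proof -
    have sub: "{p..q} \<subseteq> {a..b}" "{p..q} \<subseteq> {l..r}"
      using p q by auto
    have cont': "continuous_on {p..q} f'"
      using cont sub(1) continuous_on_subset by blast
    have "(f' has_integral (f q - f p)) {p..q}"
    proof (rule fundamental_theorem_of_calculus[OF \<open>p \<le> q\<close>])
      fix x assume "x \<in> {p..q}"
      then have "(f has_real_derivative f' x) (at x within {p..q})"
        using der sub(1) DERIV_subset by (metis subsetD)
      then show "(f has_vector_derivative f' x) (at x within {p..q})"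
        by (simp add: has_real_derivative_iff_has_vector_derivative)
    qed
    then have "\<bar>f q - f p\<bar> = \<bar>integral {p..q} f'\<bar>"
      by (simp add: integral_unique)
    also have "\<dots> \<le> integral {p..q} (\<lambda>x. \<bar>f' x\<bar>)"
      using integral_norm_bound_integral[of f' "{p..q}" "\<lambda>x. \<bar>f' x\<bar>"] cont'
      by (auto simp: integrable_continuous_interval continuous_on_rabs)
    finally have "ennreal \<bar>f q - f p\<bar> \<le> ennreal (integral {p..q} (\<lambda>x. \<bar>f' x\<bar>))"
      by (rule ennreal_leI)
    also have "\<dots> = (\<integral>\<^sup>+t. ennreal \<bar>f' t\<bar> * indicator {p..q} t \<partial>lborel)"
    proof -
      have "((\<lambda>x. \<bar>f' x\<bar>) has_integral integral {p..q} (\<lambda>x. \<bar>f' x\<bar>)) {p..q}"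
        using cont' by (intro integrable_integral integrable_continuous_interval continuous_on_rabs)
      then show ?thesis
        by (subst nn_integral_has_integral_lebesgue') auto
    qed
    also have "\<dots> \<le> (\<integral>\<^sup>+t. (ennreal \<bar>f' t\<bar> * indicator {a..b} t) * indicator {l..r} t \<partial>lborel)"
      using sub by (intro nn_integral_mono) (auto simp: indicator_def)
    finally show ?thesis .
  qed
  show ?thesis
    using main[of p q] main[of q p] p q by (cases "p \<le> q") (auto simp: abs_minus_commute)
qed

subsection \<open>Towers of derivatives\<close>

text \<open>Carrying the whole sequence of derivatives explicitly lets differences, multiples,
  contractions and antiderivatives be written as formulas in \<open>j\<close>, without recomputing
  \<open>nth_deriv\<close>.\<close>

definition tower :: "nat \<Rightarrow> (nat \<Rightarrow> real \<Rightarrow> real) \<Rightarrow> bool" where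
  "tower k d \<longleftrightarrow>
     (\<forall>j<k. \<forall>x\<in>{a..b}. (d j has_real_derivative d (Suc j) x) (at x within {a..b})) \<and>
     continuous_on {a..b} (d k)"

lemma tower_deriv:
  "tower k d \<Longrightarrow> j < k \<Longrightarrow> x \<in> {a..b} \<Longrightarrow> (d j has_real_derivative d (Suc j) x) (at x within {a..b})"
  by (simp add: tower_def)

lemma tower_continuous:
  assumes "tower k d" "j \<le> k" shows "continuous_on {a..b} (d j)"
proof (cases "j = k")
  case True
  then show ?thesis using assms by (simp add: tower_def)
next
  case False
  then have "j < k" using assms by simp
  then show ?thesis
    using tower_deriv[OF assms(1)] DERIV_continuous_on by blast
qed

lemma tower_L1: "tower k d \<Longrightarrow> j \<le> k \<Longrightarrow> d j \<in> L1 a b"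
  using tower_continuous continuous_L1 by blast

lemma tower_mono: "tower k d \<Longrightarrow> m \<le> k \<Longrightarrow> tower m d"
  using tower_continuous by (auto simp: tower_def)

lemma tower_shift: "tower (m + k) d \<Longrightarrow> tower k (\<lambda>j. d (m + j))"
  by (auto simp: tower_def)

lemma tower_diff: "tower k d \<Longrightarrow> tower k e \<Longrightarrow> tower k (\<lambda>j x. d j x - e j x)"
  by (auto simp: tower_def intro!: derivative_intros continuous_intros)

lemma tower_cmult: "tower k d \<Longrightarrow> tower k (\<lambda>j x. c * d j x)"
  by (auto simp: tower_def intro!: DERIV_cmult continuous_intros)

lemma affine_mem_Icc:
  fixes x p \<sigma> :: real
  assumes "p \<in> {a..b}" "x \<in> {a..b}" "0 \<le> \<sigma>" "\<sigma> \<le> 1"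
  shows "(1 - \<sigma>) * x + \<sigma> * p \<in> {a..b}"
  using convexD_alt[of "{a..b}" x p \<sigma>] assms by simp

text \<open>By convexity the contraction towards \<open>p\<close> maps \<open>{a..b}\<close> into
  itself, and the chain rule releases one factor 1 - \<sigma> per derivative.\<close>

lemma tower_affine:
  assumes d: "tower k d" and p: "p \<in> {a..b}" and \<sigma>: "0 \<le> \<sigma>" "\<sigma> \<le> 1"
  shows "tower k (\<lambda>j x. (1 - \<sigma>) ^ j * d j ((1 - \<sigma>) * x + \<sigma> * p))"
  unfolding tower_def
proof (intro conjI allI impI ballI)
  let ?A = "\<lambda>x. (1 - \<sigma>) * x + \<sigma> * p"
  have sub: "?A ` {a..b} \<subseteq> {a..b}"
    using affine_mem_Icc[OF p _ \<sigma>] by blast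
  fix j x assume "j < k" and x: "x \<in> {a..b}"
  then have "(d j has_real_derivative d (Suc j) (?A x)) (at (?A x) within {a..b})"
    using d affine_mem_Icc[OF p x \<sigma>] by (intro tower_deriv)
  then have "(d j has_real_derivative d (Suc j) (?A x)) (at (?A x) within ?A ` {a..b})"
    using DERIV_subset sub by blast
  moreover have "(?A has_real_derivative (1 - \<sigma>)) (at x within {a..b})"
    by (auto intro!: derivative_eq_intros)
  ultimately have "(d j \<circ> ?A has_real_derivative d (Suc j) (?A x) * (1 - \<sigma>)) (at x within {a..b})"
    by (rule DERIV_image_chain)
  from DERIV_cmult[OF this, of "(1 - \<sigma>) ^ j"]
  show "((\<lambda>x. (1 - \<sigma>) ^ j * d j (?A x)) has_real_derivative (1 - \<sigma>) ^ Suc j * d (Suc j) (?A x))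
      (at x within {a..b})"
    by (simp add: o_def mult_ac)
next
  let ?A = "\<lambda>x. (1 - \<sigma>) * x + \<sigma> * p"
  have sub: "?A ` {a..b} \<subseteq> {a..b}"
    using affine_mem_Icc[OF p _ \<sigma>] by blast
  have "continuous_on {a..b} (\<lambda>x. d k (?A x))"
    by (rule continuous_on_compose2[OF tower_continuous[OF d order_refl] _ sub])
       (intro continuous_intros)
  then show "continuous_on {a..b} (\<lambda>x. (1 - \<sigma>) ^ k * d k (?A x))"
    by (intro continuous_intros)
qed

text \<open>Substitution y = (1 - \<sigma>) x + \<sigma> p. Only an inequality results, because the
  image of \<open>{a..b}\<close> is a subinterval.\<close>

lemma norm1_affine_le:
  assumes u: "continuous_on {a..b} u" and p: "p \<in> {a..b}" and \<sigma>: "0 \<le> \<sigma>" "\<sigma> < 1"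
  shows "(1 - \<sigma>) * norm1 (\<lambda>x. u ((1 - \<sigma>) * x + \<sigma> * p)) \<le> norm1 u"
proof -
  let ?A = "\<lambda>x. (1 - \<sigma>) * x + \<sigma> * p"
  define V where "V t = ennreal \<bar>u t\<bar> * indicator {a..b} t" for t
  have [measurable]: "V \<in> borel_measurable borel"
    unfolding V_def by (rule borel_measurable_continuous_Icc[OF u])
  have sub: "?A ` {a..b} \<subseteq> {a..b}"
    using affine_mem_Icc[OF p] \<sigma> by force
  have "continuous_on {a..b} (\<lambda>x. u (?A x))"
    by (rule continuous_on_compose2[OF u _ sub]) (intro continuous_intros)
  then have "ennreal (norm1 (\<lambda>x. u (?A x))) = (\<integral>\<^sup>+x. ennreal \<bar>u (?A x)\<bar> * indicator {a..b} x \<partial>lborel)"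
    by (intro nn_integral_Icc_norm1[symmetric] continuous_L1)
  also have "\<dots> \<le> (\<integral>\<^sup>+x. V (\<sigma> * p + (1 - \<sigma>) * x) \<partial>lborel)"
    using affine_mem_Icc[OF p] \<sigma>
    by (intro nn_integral_mono) (simp add: V_def indicator_def add.commute)
  finally have "ennreal (1 - \<sigma>) * ennreal (norm1 (\<lambda>x. u (?A x)))
      \<le> ennreal (1 - \<sigma>) * (\<integral>\<^sup>+x. V (\<sigma> * p + (1 - \<sigma>) * x) \<partial>lborel)"
    by (rule mult_left_mono) simp
  also have "\<dots> = (\<integral>\<^sup>+x. V x \<partial>lborel)"
    using nn_integral_real_affine[of V "1 - \<sigma>" "\<sigma> * p"] \<sigma> by simp
  also have "\<dots> = ennreal (norm1 u)"
    unfolding V_def by (intro nn_integral_Icc_norm1 continuous_L1 u)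
  finally show ?thesis
    using \<sigma> norm1_nonneg by (simp flip: ennreal_mult')
qed

section \<open>Towers versus iterated derivatives and \<open>Ck\<close>\<close>

lemma nth_deriv_0 [simp]: "nth_deriv a b 0 \<gamma> = \<gamma>"
  and nth_deriv_Suc: "nth_deriv a b (Suc j) \<gamma> x = vector_derivative (nth_deriv a b j \<gamma>) (at x within {a..b})"
  by (simp_all add: nth_deriv_def)

text \<open>Since \<open>a < b\<close>, a derivative within \<open>{a..b}\<close> is unique at every
  point, endpoints included.\<close>

lemma nth_deriv_tower:
  assumes "tower k d" "j \<le> k" "x \<in> {a..b}"
  shows "nth_deriv a b j (d 0) x = d j x"
  using assms(2,3)
proof (induction j arbitrary: x)
  case (Suc j)
  have "(d j has_vector_derivative d (Suc j) x) (at x within {a..b})"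
    using tower_deriv[OF assms(1), of j x] Suc.prems
    by (simp add: has_real_derivative_iff_has_vector_derivative)
  then have "(nth_deriv a b j (d 0) has_vector_derivative d (Suc j) x) (at x within {a..b})"
    using Suc by - (rule has_vector_derivative_transform[where f = "d j"], auto)
  then show ?case
    using vector_derivative_within_closed_interval[OF ab] Suc.prems by (simp add: nth_deriv_Suc)
qed simp

lemma tower_Ck:
  assumes "tower k d" shows "d 0 \<in> Ck k a b"
proof -
  have "nth_deriv a b j (d 0) differentiable_on {a..b}" if "j < k" for j
    unfolding differentiable_on_def
  proof
    fix x assume x: "x \<in> {a..b}"
    have "(d j has_vector_derivative d (Suc j) x) (at x within {a..b})"
      using tower_deriv[OF assms that x] by (simp add: has_real_derivative_iff_has_vector_derivative)
    then have "(nth_deriv a b j (d 0) has_vector_derivative d (Suc j) x) (at x within {a..b})"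
      using nth_deriv_tower[OF assms] that x
      by - (rule has_vector_derivative_transform[where f = "d j"], auto)
    then show "nth_deriv a b j (d 0) differentiable at x within {a..b}"
      by (rule differentiableI_vector)
  qed
  moreover have "continuous_on {a..b} (nth_deriv a b k (d 0))"
    using tower_continuous[OF assms order_refl] nth_deriv_tower[OF assms order_refl]
    by (subst continuous_on_cong[OF refl]) auto
  ultimately show ?thesis by (simp add: Ck_def)
qed

lemma Ck_tower:
  assumes "\<gamma> \<in> Ck k a b" shows "tower k (\<lambda>j. nth_deriv a b j \<gamma>)"
  using assms
  by (auto simp: tower_def Ck_def differentiable_on_def has_real_derivative_iff_has_vector_derivative
      nth_deriv_Suc vector_derivative_works)

lemma F_fun_tower:
  assumes d: "tower k d" and g: "g \<in> L1 a b" and "0 < lam"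
  shows "F_fun k a b g lam (d 0) = ennreal (norm1 (d k) / lam ^ (k - 1) + lam * norm1 (\<lambda>x. d 0 x - g x))"
proof -
  have "(\<integral>\<^sup>+x. ennreal \<bar>nth_deriv a b k (d 0) x\<bar> \<partial>lebesgue_on {a<..<b})
      = (\<integral>\<^sup>+x. ennreal \<bar>d k x\<bar> \<partial>lebesgue_on {a<..<b})"
    using nth_deriv_tower[OF d] by (intro nn_integral_cong) auto
  also have "\<dots> = ennreal (norm1 (d k))"
    by (intro nn_integral_norm1 tower_L1[OF d]) simp
  moreover have "(\<integral>\<^sup>+x. ennreal \<bar>d 0 x - g x\<bar> \<partial>lebesgue_on {a<..<b}) = ennreal (norm1 (\<lambda>x. d 0 x - g x))"
    by (intro nn_integral_norm1 L1_diff tower_L1[OF d] g) simp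
  ultimately show ?thesis
    using \<open>0 < lam\<close> norm1_nonneg
    by (simp add: F_fun_def ennreal_plus flip: ennreal_mult')
qed

section \<open>Membership in the classes through families of approximants\<close>

lemma S_class_M_fun_le:
  assumes g: "g \<in> S_class k \<eta> a b" and \<eta>: "\<And>lam. 0 < lam \<Longrightarrow> 1 \<le> \<eta> lam"
  obtains c where "0 \<le> c"
    and "\<And>lam. 0 < lam \<Longrightarrow> M_fun k a b g lam \<le> ennreal c * ennreal (\<eta> lam)"
proof -
  define s where "s = (SUP lam\<in>{0<..}. M_fun k a b g lam / ennreal (\<eta> lam))"
  have "s < \<infinity>" using g by (simp add: S_class_def s_def)
  then obtain c where c: "0 \<le> c" "s = ennreal c"
    by (cases s) auto
  have "M_fun k a b g lam \<le> ennreal c * ennreal (\<eta> lam)" if lam: "0 < lam" for lam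
  proof -
    have "M_fun k a b g lam / ennreal (\<eta> lam) \<le> ennreal c"
      using lam unfolding c(2)[symmetric] s_def by (intro SUP_upper) simp
    then have "M_fun k a b g lam / ennreal (\<eta> lam) * ennreal (\<eta> lam) \<le> ennreal c * ennreal (\<eta> lam)"
      by (rule mult_right_mono) simp
    \<comment> \<open>As \<open>\<eta> lam \<ge> 1\<close>, the weight is neither 0 nor infinite, so
      the division can be undone in \<open>ennreal\<close>.\<close>
    then show ?thesis
      using \<eta>[OF lam] by (simp add: ennreal_divide_times ennreal_times_divide)
  qed
  with c(1) show thesis by (rule that)
qed

lemma S_class_approximants:
  assumes g: "g \<in> S_class k \<eta> a b" and \<eta>: "\<And>lam. 0 < lam \<Longrightarrow> 1 \<le> \<eta> lam"
  obtains C where "0 \<le> C"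
    and "\<And>lam. 0 < lam \<Longrightarrow> \<exists>d. tower k d \<and> norm1 (d k) \<le> C * lam ^ (k - 1) * \<eta> lam
           \<and> norm1 (\<lambda>x. d 0 x - g x) \<le> C * \<eta> lam / lam"
proof -
  from g have gL: "g \<in> L1 a b" by (simp add: S_class_def)
  obtain c where c: "0 \<le> c"
    and M_le: "\<And>lam. 0 < lam \<Longrightarrow> M_fun k a b g lam \<le> ennreal c * ennreal (\<eta> lam)"
    using S_class_M_fun_le[OF g \<eta>] by blast
  show thesis
  proof
    \<comment> \<open>The infimum need not be attained. With \<open>\<eta> lam \<ge> 1\<close>,
      passing from \<open>c\<close> to \<open>c + 1\<close> leaves strict room for a
      competitor.\<close>
    show "0 \<le> c + 1" using c by simp
    fix lam :: real assume lam: "0 < lam"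
    then have \<eta>1: "1 \<le> \<eta> lam" by (rule \<eta>)
    have "M_fun k a b g lam \<le> ennreal c * ennreal (\<eta> lam)"
      using lam by (rule M_le)
    also have "\<dots> < ennreal ((c + 1) * \<eta> lam)"
      using \<eta>1 c by (simp flip: ennreal_mult' add: ennreal_less_iff)
    finally obtain \<gamma> where \<gamma>: "\<gamma> \<in> Ck k a b" "F_fun k a b g lam \<gamma> < ennreal ((c + 1) * \<eta> lam)"
      unfolding M_fun_def INF_less_iff by blast
    define d where "d j = nth_deriv a b j \<gamma>" for j
    have d: "tower k d" unfolding d_def by (rule Ck_tower[OF \<gamma>(1)])
    have "F_fun k a b g lam (d 0) < ennreal ((c + 1) * \<eta> lam)"
      using \<gamma>(2) by (simp add: d_def)
    then have *: "norm1 (d k) / lam ^ (k - 1) + lam * norm1 (\<lambda>x. d 0 x - g x) < (c + 1) * \<eta> lam"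
      unfolding F_fun_tower[OF d gL lam] using lam norm1_nonneg by (subst (asm) ennreal_less_iff) auto
    have "0 \<le> norm1 (d k) / lam ^ (k - 1)" "0 \<le> lam * norm1 (\<lambda>x. d 0 x - g x)"
      using lam norm1_nonneg by simp_all
    with * have "norm1 (d k) / lam ^ (k - 1) \<le> (c + 1) * \<eta> lam" "lam * norm1 (\<lambda>x. d 0 x - g x) \<le> (c + 1) * \<eta> lam"
      by linarith+
    then have "norm1 (d k) \<le> (c + 1) * lam ^ (k - 1) * \<eta> lam" "norm1 (\<lambda>x. d 0 x - g x) \<le> (c + 1) * \<eta> lam / lam"
      using lam by (simp_all add: field_simps)
    then show "\<exists>d. tower k d \<and> norm1 (d k) \<le> (c + 1) * lam ^ (k - 1) * \<eta> lam
           \<and> norm1 (\<lambda>x. d 0 x - g x) \<le> (c + 1) * \<eta> lam / lam"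
      using d by blast
  qed
qed

text \<open>Only large \<open>lam\<close> matter: for \<open>lam \<le> 1\<close> the competitor \<open>\<gamma> = 0\<close> is good enough.\<close>

lemma S_classI:
  assumes g: "g \<in> L1 a b" and \<eta>: "\<And>lam. 0 < lam \<Longrightarrow> 1 \<le> \<eta> lam" and "0 \<le> C"
    and ex: "\<And>lam. 1 \<le> lam \<Longrightarrow> \<exists>d. tower k d \<and> norm1 (d k) \<le> C * lam ^ (k - 1) * \<eta> lam
           \<and> norm1 (\<lambda>x. d 0 x - g x) \<le> C * \<eta> lam / lam"
  shows "g \<in> S_class k \<eta> a b"
proof -
  \<comment> \<open>\<open>2 * C\<close> pays for the two terms of \<open>F_fun\<close> when
    \<open>lam \<ge> 1\<close>; \<open>norm1 g\<close> pays for the zero competitor when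
    \<open>lam < 1\<close>.\<close>
  let ?c = "2 * C + norm1 g"
  have "M_fun k a b g lam / ennreal (\<eta> lam) \<le> ennreal ?c" if lam: "0 < lam" for lam
  proof -
    have \<eta>1: "1 \<le> \<eta> lam" using lam by (rule \<eta>)
    obtain d where d: "tower k d"
      and le: "norm1 (d k) / lam ^ (k - 1) + lam * norm1 (\<lambda>x. d 0 x - g x) \<le> ?c * \<eta> lam"
    proof (cases "1 \<le> lam")
      case True
      then obtain d where d: "tower k d" "norm1 (d k) \<le> C * lam ^ (k - 1) * \<eta> lam"
        "norm1 (\<lambda>x. d 0 x - g x) \<le> C * \<eta> lam / lam"
        using ex by blast
      have "norm1 (d k) / lam ^ (k - 1) \<le> C * \<eta> lam" "lam * norm1 (\<lambda>x. d 0 x - g x) \<le> C * \<eta> lam"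
        using d(2,3) lam by (simp_all add: field_simps)
      moreover have "0 \<le> norm1 g * \<eta> lam"
        using norm1_nonneg \<eta>1 by simp
      ultimately show thesis
        by (intro that[OF d(1)]) (simp add: algebra_simps)
    next
      case False
      have "tower k (\<lambda>_ _. 0)"
        by (simp add: tower_def)
      moreover have "norm1 (\<lambda>x. 0) = 0"
        using norm1_cmult[of 0 "\<lambda>x. 0"] by simp
      moreover have "norm1 (\<lambda>x. 0 - g x) = norm1 g"
        using norm1_minus_commute[of "\<lambda>x. 0" g] by simp
      moreover have "lam * norm1 g \<le> \<eta> lam * norm1 g"
        using False \<eta>1 norm1_nonneg by (intro mult_right_mono) auto
      moreover have "0 \<le> 2 * C * \<eta> lam"
        using \<open>0 \<le> C\<close> \<eta>1 by simp
      ultimately show thesis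
        by (intro that[of "\<lambda>_ _. 0"]) (simp_all add: algebra_simps)
    qed
    have "M_fun k a b g lam \<le> F_fun k a b g lam (d 0)"
      unfolding M_fun_def by (intro INF_lower tower_Ck[OF d])
    also have "\<dots> \<le> ennreal (?c * \<eta> lam)"
      unfolding F_fun_tower[OF d g lam] using le by (rule ennreal_leI)
    finally have "M_fun k a b g lam / ennreal (\<eta> lam) \<le> ennreal (?c * \<eta> lam) / ennreal (\<eta> lam)"
      by (rule divide_right_mono_ennreal)
    also have "\<dots> = ennreal ?c"
      using \<eta>1 \<open>0 \<le> C\<close> norm1_nonneg[of g] by (subst divide_ennreal) auto
    finally show ?thesis .
  qed
  then have "(SUP lam\<in>{0<..}. M_fun k a b g lam / ennreal (\<eta> lam)) \<le> ennreal ?c"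
    by (intro SUP_least) auto
  also have "\<dots> < \<infinity>" by simp
  finally show ?thesis
    using g by (simp add: S_class_def)
qed

subsection \<open>Interpolation and smoothing\<close>

lemma mean_value_Icc:
  assumes der: "\<And>x. x \<in> {a..b} \<Longrightarrow> (f has_real_derivative f' x) (at x within {a..b})"
    and "p \<in> {a..b}" "q \<in> {a..b}"
  obtains \<xi> where "\<xi> \<in> {a..b}" "min p q \<le> \<xi>" "\<xi> \<le> max p q" "f q - f p = (q - p) * f' \<xi>"
proof -
  have main: "\<exists>\<xi>\<in>{p..q}. f q - f p = (q - p) * f' \<xi>" if "p \<in> {a..b}" "q \<in> {a..b}" "p \<le> q" for p q
  proof -
    have "\<exists>\<xi>\<in>{p..q}. f q - f p = (\<lambda>h. f' \<xi> * h) (q - p)"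
    proof (rule mvt_very_simple[OF \<open>p \<le> q\<close>])
      fix x assume "p \<le> x" "x \<le> q"
      then have "(f has_real_derivative f' x) (at x within {p..q})"
        using der[of x] that by (auto intro: DERIV_subset)
      then show "(f has_derivative (\<lambda>h. f' x * h)) (at x within {p..q})"
        by (simp add: has_field_derivative_def)
    qed
    then show ?thesis by (simp add: mult.commute)
  qed
  show thesis
  proof (cases "p \<le> q")
    case True
    then obtain \<xi> where "\<xi> \<in> {p..q}" "f q - f p = (q - p) * f' \<xi>"
      using main assms(2,3) by blast
    then show thesis using True assms(2,3) by (intro that[of \<xi>]) auto
  next
    case False
    then obtain \<xi> where "\<xi> \<in> {q..p}" "f p - f q = (p - q) * f' \<xi>"
      using main[of q p] assms(2,3) by auto
    then show thesis using False assms(2,3) by (intro that[of \<xi>]) (auto simp: algebra_simps)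
  qed
qed

text \<open>As \<open>h\<close> is at most half the length of the interval, x + h or x - h stays in
  it. The difference quotient towards that point equals \<open>d 1\<close> at some intermediate
  \<xi>, and the change of \<open>d 1\<close> from x to \<xi> is at most the integral of
  |\<open>d 2\<close>| over [x - h, x + h]. Integration in x turns three translates of
  |\<open>d 0\<close>| into \<open>3 / h\<close>, and the window into \<open>2 * h\<close>.\<close>

lemma norm1_first_derivative_le:
  assumes d: "tower 2 d" and h: "0 < h" "h \<le> (b - a) / 2"
  shows "norm1 (d 1) \<le> 3 / h * norm1 (d 0) + 2 * h * norm1 (d 2)"
proof -
  define V where "V j t = ennreal \<bar>d j t\<bar> * indicator {a..b} t" for j t
  define W where "W x = (\<integral>\<^sup>+t. V 2 t * indicator {x - h..x + h} t \<partial>lborel)" for x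
  have V_meas [measurable]: "V j \<in> borel_measurable borel" if "j \<le> 2" for j
    unfolding V_def by (intro borel_measurable_continuous_Icc tower_continuous[OF d that])
  have [measurable]: "V 0 \<in> borel_measurable borel" "V 2 \<in> borel_measurable borel"
    by (simp_all add: V_meas)
  have V_int: "(\<integral>\<^sup>+t. V j t \<partial>lborel) = ennreal (norm1 (d j))" if "j \<le> 2" for j
    unfolding V_def by (intro nn_integral_Icc_norm1 tower_L1[OF d that])
  have W_meas [measurable]: "W \<in> borel_measurable borel"
    unfolding W_def by (simp add: indicator_def, measurable)
  \<comment> \<open>The form \<open>h + 1 * x\<close> is that of the affine substitution rule used
    for \<open>shift\<close> below.\<close>
  have pointwise: "V 1 x \<le> ennreal (1 / h) * (V 0 (h + 1 * x) + V 0 (- h + 1 * x) + V 0 x) + W x" for x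
  proof (cases "x \<in> {a..b}")
    case False
    then show ?thesis by (simp add: V_def)
  next
    case x: True
    obtain s where s: "x + s \<in> {a..b}" "\<bar>s\<bar> = h"
    proof (cases "x \<le> (a + b) / 2")
      case True
      then show thesis using x h by (intro that[of h]) auto
    next
      case False
      then show thesis using x h by (intro that[of "- h"]) auto
    qed
    obtain \<xi> where \<xi>: "\<xi> \<in> {a..b}" "min x (x + s) \<le> \<xi>" "\<xi> \<le> max x (x + s)"
      and eq: "d 0 (x + s) - d 0 x = (x + s - x) * d 1 \<xi>"
      by (rule mean_value_Icc[of "d 0" "d 1" x "x + s"]) (use tower_deriv[OF d, of 0] x s in auto)
    have win: "ennreal \<bar>d 1 x - d 1 \<xi>\<bar> \<le> W x"
      unfolding W_def V_def
      by (rule increment_le_nn_integral)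
         (use tower_deriv[OF d, of 1] tower_continuous[OF d, of 2] x \<xi> s in \<open>auto simp: numeral_2_eq_2\<close>)
    have "\<bar>d 1 \<xi>\<bar> = \<bar>d 0 (x + s) - d 0 x\<bar> / h"
      using eq s h by (simp add: abs_mult)
    also have "\<dots> \<le> 1 / h * (\<bar>d 0 (x + s)\<bar> + \<bar>d 0 x\<bar>)"
      using h by (simp add: divide_right_mono)
    finally have "\<bar>d 1 x\<bar> \<le> 1 / h * (\<bar>d 0 (x + s)\<bar> + \<bar>d 0 x\<bar>) + \<bar>d 1 x - d 1 \<xi>\<bar>"
      by linarith
    then have "ennreal \<bar>d 1 x\<bar> \<le> ennreal (1 / h * (\<bar>d 0 (x + s)\<bar> + \<bar>d 0 x\<bar>) + \<bar>d 1 x - d 1 \<xi>\<bar>)"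
      by (rule ennreal_leI)
    also have "\<dots> = ennreal (1 / h) * (ennreal \<bar>d 0 (x + s)\<bar> + ennreal \<bar>d 0 x\<bar>) + ennreal \<bar>d 1 x - d 1 \<xi>\<bar>"
    proof -
      have "0 \<le> 1 / h" using h by simp
      then show ?thesis
        by (simp only: ennreal_plus ennreal_mult' abs_ge_zero mult_nonneg_nonneg add_nonneg_nonneg)
    qed
    also have "\<dots> \<le> ennreal (1 / h) * (V 0 (h + 1 * x) + V 0 (- h + 1 * x) + V 0 x) + W x"
    proof (intro add_mono mult_left_mono win)
      have "ennreal \<bar>d 0 (x + s)\<bar> = V 0 (x + s)"
        using s by (simp add: V_def)
      \<comment> \<open>The sign of \<open>s\<close> depends on \<open>x\<close>; adding both
        translates gives one expression valid for all \<open>x\<close>.\<close>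
      also have "\<dots> \<le> V 0 (h + 1 * x) + V 0 (- h + 1 * x)"
        using s(2) h by (cases "0 \<le> s") (auto simp: add.commute)
      finally show "ennreal \<bar>d 0 (x + s)\<bar> \<le> V 0 (h + 1 * x) + V 0 (- h + 1 * x)" .
      show "ennreal \<bar>d 0 x\<bar> \<le> V 0 x" using x by (simp add: V_def)
    qed simp
    finally show ?thesis using x by (simp add: V_def)
  qed
  have shift: "(\<integral>\<^sup>+x. V 0 (c + 1 * x) \<partial>lborel) = ennreal (norm1 (d 0))" for c
    using nn_integral_real_affine[of "V 0" 1 c] V_int[of 0] by simp
  have "ennreal (norm1 (d 1)) = (\<integral>\<^sup>+x. V 1 x \<partial>lborel)"
    by (simp add: V_int)
  also have "\<dots> \<le> (\<integral>\<^sup>+x. ennreal (1 / h) * (V 0 (h + 1 * x) + V 0 (- h + 1 * x) + V 0 x) + W x \<partial>lborel)"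
    by (intro nn_integral_mono pointwise)
  also have "\<dots> = ennreal (1 / h) * ((\<integral>\<^sup>+x. V 0 (h + 1 * x) \<partial>lborel) + (\<integral>\<^sup>+x. V 0 (- h + 1 * x) \<partial>lborel)
      + (\<integral>\<^sup>+x. V 0 x \<partial>lborel)) + (\<integral>\<^sup>+x. W x \<partial>lborel)"
    by (simp add: nn_integral_add nn_integral_cmult)
  also have "(\<integral>\<^sup>+x. W x \<partial>lborel) = ennreal (2 * h) * ennreal (norm1 (d 2))"
    unfolding W_def using h V_int[of 2] by (subst nn_integral_window) auto
  also have "ennreal (1 / h) * ((\<integral>\<^sup>+x. V 0 (h + 1 * x) \<partial>lborel) + (\<integral>\<^sup>+x. V 0 (- h + 1 * x) \<partial>lborel)
      + (\<integral>\<^sup>+x. V 0 x \<partial>lborel)) = ennreal (3 / h * norm1 (d 0))"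
    using h norm1_nonneg V_int[of 0] unfolding shift
    by (simp flip: ennreal_plus ennreal_mult' add: field_simps)
  also have "ennreal (3 / h * norm1 (d 0)) + ennreal (2 * h) * ennreal (norm1 (d 2))
      = ennreal (3 / h * norm1 (d 0) + 2 * h * norm1 (d 2))"
    using h norm1_nonneg by (simp add: ennreal_plus ennreal_mult')
  finally show ?thesis
    using h norm1_nonneg by (subst (asm) ennreal_le_iff) auto
qed

text \<open>Induction on \<open>k\<close>: the first-derivative inequality applied to
  \<open>d k\<close> bounds \<open>d (Suc k)\<close> by \<open>d k\<close> and
  \<open>d (Suc (Suc k))\<close>, while the hypothesis bounds \<open>d k\<close> by
  \<open>d 0\<close> and by \<open>d (Suc k)\<close> again. The returning term gets the coefficient
  3 * C * \<epsilon> = 1/2, which is what fixes \<epsilon>.\<close>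

lemma landau_top:
  assumes "1 \<le> k"
  shows "\<exists>C\<ge>1. \<forall>d h. tower (Suc k) d \<longrightarrow> 0 < h \<longrightarrow> h \<le> (b - a) / 2 \<longrightarrow>
           norm1 (d k) \<le> C * (norm1 (d 0) / h ^ k + h * norm1 (d (Suc k)))"
  using assms
proof (induction k rule: nat_induct_at_least)
  case base
  show ?case
  proof (intro exI[of _ 3] conjI allI impI)
    fix d h assume d: "tower (Suc 1) d" and h: "0 < h" "h \<le> (b - a) / 2"
    have "norm1 (d 1) \<le> 3 / h * norm1 (d 0) + 2 * h * norm1 (d 2)"
      using norm1_first_derivative_le[OF _ h] d by (simp add: numeral_2_eq_2)
    moreover have "0 \<le> h * norm1 (d 2)" using h norm1_nonneg by simp
    ultimately show "norm1 (d 1) \<le> 3 * (norm1 (d 0) / h ^ 1 + h * norm1 (d (Suc 1)))"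
      by (simp add: numeral_2_eq_2 algebra_simps)
  qed simp
next
  case (Suc k)
  then obtain C where C: "1 \<le> C" and IH: "\<And>d h. tower (Suc k) d \<Longrightarrow> 0 < h \<Longrightarrow> h \<le> (b - a) / 2 \<Longrightarrow>
           norm1 (d k) \<le> C * (norm1 (d 0) / h ^ k + h * norm1 (d (Suc k)))"
    by blast
  txt \<open>With the induction hypothesis at scale \<open>\<epsilon> * h\<close>, half of \<open>norm1 (d (Suc k))\<close> can be absorbed.\<close>
  define \<epsilon> where "\<epsilon> = 1 / (6 * C)"
  have \<epsilon>: "0 < \<epsilon>" "\<epsilon> \<le> 1" "6 * (C * \<epsilon>) = 1" using C by (auto simp: \<epsilon>_def)
  \<comment> \<open>After absorption the highest derivative has coefficient 4, namely twice the
    \<open>2 * h\<close> of the first-derivative inequality; the common constant has to cover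
    it.\<close>
  have C': "4 \<le> 6 * C / \<epsilon> ^ k"
  proof -
    have "\<epsilon> ^ k \<le> 1" using \<epsilon> by (simp add: power_le_one)
    then have "4 * \<epsilon> ^ k \<le> 6 * C" using C by linarith
    then show ?thesis using \<epsilon> by (simp add: field_simps)
  qed
  show ?case
  proof (intro exI[of _ "6 * C / \<epsilon> ^ k"] conjI allI impI)
    show "1 \<le> 6 * C / \<epsilon> ^ k" using C' by simp
    fix d h assume d: "tower (Suc (Suc k)) d" and h: "0 < h" "h \<le> (b - a) / 2"
    define n where "n j = norm1 (d j)" for j
    have n: "0 \<le> n j" for j unfolding n_def by (rule norm1_nonneg)
    have "tower (k + 2) d" using d by simp
    then have 1: "n (Suc k) \<le> 3 / h * n k + 2 * h * n (Suc (Suc k))"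
      using norm1_first_derivative_le[OF tower_shift h] by (fastforce simp: n_def)
    have "\<epsilon> * h \<le> h" using \<epsilon> h by (simp add: mult_left_le_one_le)
    then have "n k \<le> C * (n 0 / (\<epsilon> * h) ^ k + \<epsilon> * h * n (Suc k))"
      unfolding n_def using h \<epsilon> \<open>\<epsilon> * h \<le> h\<close>
      by (intro IH tower_mono[OF d] order_trans[OF \<open>\<epsilon> * h \<le> h\<close> h(2)]) simp_all
    then have "3 / h * n k \<le> 3 / h * (C * (n 0 / (\<epsilon> * h) ^ k + \<epsilon> * h * n (Suc k)))"
      using h by (intro mult_left_mono) auto
    also have "\<dots> = 3 * C / \<epsilon> ^ k * (n 0 / h ^ Suc k) + 3 * (C * \<epsilon>) * n (Suc k)"
      using h \<epsilon>(1) by (simp add: field_simps power_mult_distrib)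
    also have "3 * (C * \<epsilon>) = 1 / 2" using \<epsilon>(3) by simp
    finally have "n (Suc k) \<le> 2 * (3 * C / \<epsilon> ^ k * (n 0 / h ^ Suc k)) + 4 * (h * n (Suc (Suc k)))"
      using 1 by simp
    moreover have "4 * (h * n (Suc (Suc k))) \<le> 6 * C / \<epsilon> ^ k * (h * n (Suc (Suc k)))"
      using C' h n by (intro mult_right_mono) auto
    moreover have "2 * (3 * C / \<epsilon> ^ k * (n 0 / h ^ Suc k)) = 6 * C / \<epsilon> ^ k * (n 0 / h ^ Suc k)"
      by simp
    ultimately have "n (Suc k) \<le> 6 * C / \<epsilon> ^ k * (n 0 / h ^ Suc k) + 6 * C / \<epsilon> ^ k * (h * n (Suc (Suc k)))"
      by linarith
    then show "norm1 (d (Suc k)) \<le> 6 * C / \<epsilon> ^ k * (norm1 (d 0) / h ^ Suc k + h * norm1 (d (Suc (Suc k))))"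
      unfolding n_def by (simp only: distrib_left)
  qed
qed

text \<open>Induction on \<open>k\<close> with \<open>m\<close> fixed: in the bound for
  \<open>k\<close>, \<open>landau_top\<close> trades \<open>d k\<close> for \<open>d 0\<close> and
  \<open>d (Suc k)\<close>. The exponents match because h^(k-m) / h^k = 1 / h^m.\<close>

lemma landau:
  assumes "1 \<le> m" "Suc m \<le> k"
  shows "\<exists>C\<ge>1. \<forall>d h. tower k d \<longrightarrow> 0 < h \<longrightarrow> h \<le> (b - a) / 2 \<longrightarrow>
           norm1 (d m) \<le> C * (norm1 (d 0) / h ^ m + h ^ (k - m) * norm1 (d k))"
  using assms(2)
proof (induction k rule: nat_induct_at_least)
  case base
  then show ?case using landau_top[OF assms(1)] by simp
next
  case (Suc k)
  then obtain C where C: "1 \<le> C" and IH: "\<And>d h. tower k d \<Longrightarrow> 0 < h \<Longrightarrow> h \<le> (b - a) / 2 \<Longrightarrow>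
           norm1 (d m) \<le> C * (norm1 (d 0) / h ^ m + h ^ (k - m) * norm1 (d k))"
    by blast
  have "1 \<le> k" using Suc.hyps by simp
  from landau_top[OF this] obtain C' where C': "1 \<le> C'"
    and top: "\<And>d h. tower (Suc k) d \<Longrightarrow> 0 < h \<Longrightarrow> h \<le> (b - a) / 2 \<Longrightarrow>
           norm1 (d k) \<le> C' * (norm1 (d 0) / h ^ k + h * norm1 (d (Suc k)))"
    by blast
  show ?case
  proof (intro exI[of _ "C * (1 + C')"] conjI allI impI)
    have "1 * 1 \<le> C * (1 + C')" using C C' by (intro mult_mono) auto
    then show "1 \<le> C * (1 + C')" by simp
    fix d h assume d: "tower (Suc k) d" and h: "0 < h" "h \<le> (b - a) / 2"
    define n where "n j = norm1 (d j)" for j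
    have n: "0 \<le> n j" for j unfolding n_def by (rule norm1_nonneg)
    have "h ^ (k - m) * n k \<le> h ^ (k - m) * (C' * (n 0 / h ^ k + h * n (Suc k)))"
      using top[OF d h] h unfolding n_def by (intro mult_left_mono) auto
    also have "\<dots> = C' * (n 0 * (h ^ (k - m) / h ^ k) + h ^ Suc (k - m) * n (Suc k))"
      by (simp add: algebra_simps)
    also have "h ^ (k - m) / h ^ k = 1 / h ^ m"
      using h Suc.hyps by (simp add: field_simps flip: power_add)
    also have "Suc (k - m) = Suc k - m"
      using Suc.hyps by simp
    finally have *: "h ^ (k - m) * n k \<le> C' * (n 0 / h ^ m + h ^ (Suc k - m) * n (Suc k))"
      by simp
    have "n m \<le> C * (n 0 / h ^ m + h ^ (k - m) * n k)"
      unfolding n_def by (rule IH[OF tower_mono[OF d] h]) simp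
    also have "\<dots> \<le> C * (n 0 / h ^ m + C' * (n 0 / h ^ m + h ^ (Suc k - m) * n (Suc k)))"
      using * C by (intro mult_left_mono add_left_mono) auto
    also have "\<dots> \<le> C * (1 + C') * (n 0 / h ^ m + h ^ (Suc k - m) * n (Suc k))"
    proof -
      have "0 \<le> C * (h ^ (Suc k - m) * n (Suc k))"
        using C h n by simp
      then show ?thesis by (simp add: algebra_simps add_divide_distrib)
    qed
    finally show "norm1 (d m) \<le> C * (1 + C') * (norm1 (d 0) / h ^ m + h ^ (Suc k - m) * norm1 (d (Suc k)))"
      by (simp add: n_def)
  qed
qed

section \<open>Smoothing by averages along contractions\<close>

lemma tower_antiderivative:
  assumes d: "tower k d"
  shows "tower (Suc k) (case_nat (\<lambda>x. integral {a..x} (d 0)) d)"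
  unfolding tower_def
proof (intro conjI allI impI ballI)
  fix j x assume j: "j < Suc k" and x: "x \<in> {a..b}"
  show "(case_nat (\<lambda>x. integral {a..x} (d 0)) d j has_real_derivative
      case_nat (\<lambda>x. integral {a..x} (d 0)) d (Suc j) x) (at x within {a..b})"
  proof (cases j)
    case 0
    have "continuous_on {a..b} (d 0)" by (rule tower_continuous[OF d]) simp
    then show ?thesis
      using integral_has_real_derivative x 0 by simp
  next
    case (Suc i)
    then show ?thesis using tower_deriv[OF d] j x by simp
  qed
qed (use tower_continuous[OF d order_refl] in simp)

text \<open>With F an antiderivative of \<open>d 0\<close>, the average over z of \<open>d 0\<close>
  at (1 - t) x + t z is (F((1 - t) x + t b) - F((1 - t) x + t a)) / (t (b - a)), which is one order
  smoother than \<open>d 0\<close>. Here t is \<theta> or 2 * \<theta>, and \<theta> \<le> 1/4 keeps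
  both below 1. The constant 5 is 2 * 2 + 2 * 1/2, the coefficients of the two averages times the
  two endpoint terms of each.\<close>

lemma smoothing:
  assumes d: "tower k d" and k: "1 \<le> k" and \<theta>: "0 < \<theta>" "\<theta> \<le> 1 / 4"
  obtains e where "tower (Suc k) e"
    and "norm1 (e (Suc k)) \<le> 5 / (\<theta> * (b - a)) * norm1 (d k)"
    and "norm1 (\<lambda>x. e 0 x - d 0 x) \<le> 8 * (\<theta> * (b - a)) * norm1 (d 1)"
    and "2 \<le> k \<Longrightarrow> norm1 (\<lambda>x. e 0 x - d 0 x) \<le> 4 * (\<theta> * (b - a))\<^sup>2 * norm1 (d 2)"
proof -
  define L where "L = b - a"
  have L: "0 < L" using ab by (simp add: L_def)
  define D where "D = case_nat (\<lambda>x. integral {a..x} (d 0)) d"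
  have D: "tower (Suc k) D" unfolding D_def by (rule tower_antiderivative[OF d])
  have D_Suc: "D (Suc j) = d j" for j by (simp add: D_def)
  define E where "E \<sigma> p j x = (1 - \<sigma>) ^ j * D j ((1 - \<sigma>) * x + \<sigma> * p)" for \<sigma> p j x
  \<comment> \<open>At \<open>j = 0\<close> this is twice the average with parameter \<theta> minus
    the average with parameter 2 * \<theta>, both written as difference quotients of the
    antiderivative \<open>D 0\<close>.\<close>
  define e where "e j x = 2 / (\<theta> * L) * (E \<theta> b j x - E \<theta> a j x)
      - 1 / (2 * \<theta> * L) * (E (2 * \<theta>) b j x - E (2 * \<theta>) a j x)" for j x
  have E: "tower (Suc k) (E \<sigma> p)" if "p \<in> {a..b}" "0 \<le> \<sigma>" "\<sigma> \<le> 1" for \<sigma> p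
    using tower_affine[OF D that] by (simp add: E_def[abs_def])
  have mem: "a \<in> {a..b}" "b \<in> {a..b}" using ab by auto
  have e: "tower (Suc k) e"
    unfolding e_def[abs_def] using \<theta> mem by (intro tower_diff tower_cmult E) auto
  have E_norm: "norm1 (E \<sigma> p (Suc k)) \<le> norm1 (d k)" and E_L1: "E \<sigma> p (Suc k) \<in> L1 a b"
    if p: "p \<in> {a..b}" and \<sigma>: "0 \<le> \<sigma>" "\<sigma> < 1" for \<sigma> p
  proof -
    let ?u = "\<lambda>x. d k ((1 - \<sigma>) * x + \<sigma> * p)"
    \<comment> \<open>One of the \<open>Suc k\<close> factors 1 - \<sigma> is spent on the change of
      variables; the others are at most 1.\<close>
    have "norm1 (E \<sigma> p (Suc k)) = (1 - \<sigma>) ^ k * ((1 - \<sigma>) * norm1 ?u)"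
      using norm1_cmult[of "(1 - \<sigma>) ^ Suc k" ?u] \<sigma> by (simp add: E_def[abs_def] D_Suc mult_ac)
    also have "\<dots> \<le> 1 * norm1 (d k)"
      using norm1_affine_le[OF tower_continuous[OF d order_refl] p \<sigma>] \<sigma> norm1_nonneg
      by (intro mult_mono power_le_one) auto
    finally show "norm1 (E \<sigma> p (Suc k)) \<le> norm1 (d k)" by simp
    show "E \<sigma> p (Suc k) \<in> L1 a b"
      using tower_L1[OF E[OF p]] \<sigma> by simp
  qed
  have diff_norm: "norm1 (\<lambda>x. c * (E \<sigma> b (Suc k) x - E \<sigma> a (Suc k) x)) \<le> c * (2 * norm1 (d k))"
    if "0 \<le> \<sigma>" "\<sigma> < 1" "0 \<le> c" for \<sigma> c
  proof -
    have "norm1 (\<lambda>x. E \<sigma> b (Suc k) x - E \<sigma> a (Suc k) x) \<le> norm1 (E \<sigma> b (Suc k)) + norm1 (E \<sigma> a (Suc k))"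
      by (intro norm1_diff E_L1 mem that)
    also have "\<dots> \<le> 2 * norm1 (d k)"
      using E_norm[OF mem(1) that(1,2)] E_norm[OF mem(2) that(1,2)] by simp
    finally show ?thesis
      unfolding norm1_cmult using \<open>0 \<le> c\<close> by (simp add: mult_left_mono)
  qed
  have L1_diff': "(\<lambda>x. c * (E \<sigma> b (Suc k) x - E \<sigma> a (Suc k) x)) \<in> L1 a b" if "0 \<le> \<sigma>" "\<sigma> < 1" for \<sigma> c
    using E_L1[OF mem(1) that] E_L1[OF mem(2) that] unfolding L1_iff by auto
  have "norm1 (e (Suc k)) \<le> 2 / (\<theta> * L) * (2 * norm1 (d k)) + 1 / (2 * \<theta> * L) * (2 * norm1 (d k))"
    unfolding e_def[abs_def] using \<theta> L
    by (intro order_trans[OF norm1_diff add_mono] L1_diff' diff_norm) auto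
  also have "\<dots> = 5 / (\<theta> * L) * norm1 (d k)"
    using \<theta> L by (simp add: field_simps)
  finally have e_norm: "norm1 (e (Suc k)) \<le> 5 / (\<theta> * L) * norm1 (d k)" .

  have d0: "(d 0 has_real_derivative d 1 x) (at x within {a..b})" if "x \<in> {a..b}" for x
    using tower_deriv[OF d _ that, of 0] k by simp
  have c1: "continuous_on {a..b} (d 1)" by (rule tower_continuous[OF d k])
  have second_diff: "\<exists>z\<in>{a..b}. e 0 x - d 0 x =
      2 * d 0 ((1 - \<theta>) * x + \<theta> * z) - d 0 ((1 - 2 * \<theta>) * x + 2 * \<theta> * z) - d 0 x" if x: "x \<in> {a..b}" for x
  proof -
    txt \<open>\<open>(b - a) * (e 0 x - d 0 x)\<close> is an increment of \<open>R\<close>, so the mean value theorem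
      replaces the average over \<open>z\<close> by a single \<open>z\<close>.\<close>
    define R where "R z = 2 / \<theta> * D 0 ((1 - \<theta>) * x + \<theta> * z)
      - 1 / (2 * \<theta>) * D 0 ((1 - 2 * \<theta>) * x + 2 * \<theta> * z) - z * d 0 x" for z
    \<comment> \<open>The roles are exchanged: as a function of \<open>z\<close> the argument is a
      contraction towards \<open>x\<close>, so \<open>tower_affine\<close> applies with base point
      \<open>x\<close> and parameter 1 - \<sigma>.\<close>
    have der: "((\<lambda>z. D 0 ((1 - \<sigma>) * x + \<sigma> * z)) has_real_derivative \<sigma> * d 0 ((1 - \<sigma>) * x + \<sigma> * z)) (at z within {a..b})"
      if "z \<in> {a..b}" "0 \<le> \<sigma>" "\<sigma> \<le> 1" for \<sigma> z
      using tower_deriv[OF tower_affine[OF D x, of "1 - \<sigma>"], of 0 z] that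
      by (simp add: D_Suc add.commute)
    have "(R has_real_derivative
        2 * d 0 ((1 - \<theta>) * x + \<theta> * z) - d 0 ((1 - 2 * \<theta>) * x + 2 * \<theta> * z) - d 0 x) (at z within {a..b})"
      if z: "z \<in> {a..b}" for z
      unfolding R_def using \<theta>
      by (auto intro!: derivative_eq_intros der[OF z])
    then obtain z where z: "z \<in> {a..b}"
      "R b - R a = (b - a) * (2 * d 0 ((1 - \<theta>) * x + \<theta> * z) - d 0 ((1 - 2 * \<theta>) * x + 2 * \<theta> * z) - d 0 x)"
      by (rule mean_value_Icc[where f = R and p = a and q = b]) (use mem in auto)
    moreover have "R b - R a = L * (e 0 x - d 0 x)"
      using L \<theta> unfolding R_def e_def E_def by (simp add: field_simps) (simp add: L_def algebra_simps)
    ultimately have "L * (e 0 x - d 0 x) =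
        L * (2 * d 0 ((1 - \<theta>) * x + \<theta> * z) - d 0 ((1 - 2 * \<theta>) * x + 2 * \<theta> * z) - d 0 x)"
      by (simp add: L_def)
    then show ?thesis using z(1) L by auto
  qed
  \<comment> \<open>The farthest point of the second difference, the one with parameter 2 *
    \<theta>, lies within this distance of \<open>x\<close>.\<close>
  define H where "H = 2 * (\<theta> * L)"
  define W where "W m x = (\<integral>\<^sup>+t. (ennreal \<bar>d m t\<bar> * indicator {a..b} t) * indicator {x - H..x + H} t \<partial>lborel)" for m x
  have e0: "continuous_on {a..b} (\<lambda>x. e 0 x - d 0 x)"
    by (intro continuous_on_diff tower_continuous[OF e] tower_continuous[OF d]) auto
  have H: "0 \<le> H" using \<theta> L by (simp add: H_def)
  have pts: "(1 - \<sigma>) * x + \<sigma> * z \<in> {a..b}" "(1 - \<sigma>) * x + \<sigma> * z \<in> {x - H..x + H}"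
    if "x \<in> {a..b}" "z \<in> {a..b}" "0 \<le> \<sigma>" "\<sigma> \<le> 2 * \<theta>" for \<sigma> x z
  proof -
    show "(1 - \<sigma>) * x + \<sigma> * z \<in> {a..b}"
      using that \<theta> by (intro affine_mem_Icc) auto
    have "\<bar>\<sigma> * (z - x)\<bar> \<le> 2 * \<theta> * L"
      unfolding abs_mult using that by (intro mult_mono) (auto simp: L_def)
    then show "(1 - \<sigma>) * x + \<sigma> * z \<in> {x - H..x + H}"
      by (auto simp: H_def abs_le_iff algebra_simps)
  qed
  have "norm1 (\<lambda>x. e 0 x - d 0 x) \<le> 2 * (2 * H) * norm1 (d 1)"
  proof (rule norm1_le_window[OF e0 c1 H])
    fix x assume x: "x \<in> {a..b}"
    then obtain z where z: "z \<in> {a..b}" and eq: "e 0 x - d 0 x =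
        2 * d 0 ((1 - \<theta>) * x + \<theta> * z) - d 0 ((1 - 2 * \<theta>) * x + 2 * \<theta> * z) - d 0 x"
      using second_diff by blast
    let ?y = "(1 - \<theta>) * x + \<theta> * z" and ?y' = "(1 - 2 * \<theta>) * x + 2 * \<theta> * z"
    have "\<bar>e 0 x - d 0 x\<bar> \<le> \<bar>d 0 ?y - d 0 x\<bar> + \<bar>d 0 ?y - d 0 ?y'\<bar>"
      unfolding eq by linarith
    then have "ennreal \<bar>e 0 x - d 0 x\<bar> \<le> ennreal \<bar>d 0 ?y - d 0 x\<bar> + ennreal \<bar>d 0 ?y - d 0 ?y'\<bar>"
      by (simp flip: ennreal_plus)
    also have "\<dots> \<le> W 1 x + W 1 x"
      unfolding W_def using pts[OF x z, of \<theta>] pts[OF x z, of "2 * \<theta>"] x H \<theta>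
      by (intro add_mono increment_le_nn_integral[OF d0 c1]) auto
    also have "\<dots> = ennreal 2 * W 1 x"
      by (simp add: mult_2)
    finally show "ennreal \<bar>e 0 x - d 0 x\<bar> \<le> ennreal 2 *
        (\<integral>\<^sup>+t. ennreal \<bar>d 1 t\<bar> * indicator {a..b} t * indicator {x - H..x + H} t \<partial>lborel)"
      by (simp add: W_def)
  qed simp
  then have err1: "norm1 (\<lambda>x. e 0 x - d 0 x) \<le> 8 * (\<theta> * L) * norm1 (d 1)"
    by (simp add: H_def)
  have err2: "norm1 (\<lambda>x. e 0 x - d 0 x) \<le> 4 * (\<theta> * L)\<^sup>2 * norm1 (d 2)" if "2 \<le> k"
  proof -
    have d1: "(d 1 has_real_derivative d 2 x) (at x within {a..b})" if "x \<in> {a..b}" for x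
      using tower_deriv[OF d _ that, of 1] \<open>2 \<le> k\<close> by (simp add: numeral_2_eq_2)
    have c2: "continuous_on {a..b} (d 2)" by (rule tower_continuous[OF d \<open>2 \<le> k\<close>])
    have "norm1 (\<lambda>x. e 0 x - d 0 x) \<le> \<theta> * L * (2 * H) * norm1 (d 2)"
    proof (rule norm1_le_window[OF e0 c2 H])
      show "0 \<le> \<theta> * L" using \<theta> L by simp
      fix x assume x: "x \<in> {a..b}"
      then obtain z where z: "z \<in> {a..b}" and eq: "e 0 x - d 0 x =
          2 * d 0 ((1 - \<theta>) * x + \<theta> * z) - d 0 ((1 - 2 * \<theta>) * x + 2 * \<theta> * z) - d 0 x"
        using second_diff by blast
      define y where "y = (1 - \<theta>) * x + \<theta> * z"
      define y' where "y' = (1 - 2 * \<theta>) * x + 2 * \<theta> * z"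
      have y: "y \<in> {a..b}" "y \<in> {x - H..x + H}" and y': "y' \<in> {a..b}" "y' \<in> {x - H..x + H}"
        unfolding y_def y'_def using pts[OF x z, of \<theta>] pts[OF x z, of "2 * \<theta>"] \<theta> by auto
      have steps: "y - x = \<theta> * (z - x)" "y' - y = \<theta> * (z - x)"
        by (simp_all add: y_def y'_def algebra_simps)
      obtain \<xi> where \<xi>: "\<xi> \<in> {a..b}" "min x y \<le> \<xi>" "\<xi> \<le> max x y" "d 0 y - d 0 x = (y - x) * d 1 \<xi>"
        using mean_value_Icc[OF d0 x y(1)] by blast
      obtain \<xi>' where \<xi>': "\<xi>' \<in> {a..b}" "min y y' \<le> \<xi>'" "\<xi>' \<le> max y y'" "d 0 y' - d 0 y = (y' - y) * d 1 \<xi>'"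
        using mean_value_Icc[OF d0 y(1) y'(1)] by blast
      \<comment> \<open>The points x, y, y' are equally spaced, so both increments carry the same
        factor \<theta> * (z - x) and only a difference of two values of \<open>d 1\<close> remains.
        It is bounded through \<open>d 2\<close>.\<close>
      have "e 0 x - d 0 x = (d 0 y - d 0 x) - (d 0 y' - d 0 y)"
        unfolding eq y_def y'_def by simp
      also have "\<dots> = \<theta> * (z - x) * (d 1 \<xi> - d 1 \<xi>')"
        unfolding \<xi>(4) \<xi>'(4) steps by (simp add: algebra_simps)
      finally have "\<bar>e 0 x - d 0 x\<bar> = \<theta> * \<bar>z - x\<bar> * \<bar>d 1 \<xi> - d 1 \<xi>'\<bar>"
        using \<theta> by (simp add: abs_mult)
      also have "\<dots> \<le> \<theta> * L * \<bar>d 1 \<xi> - d 1 \<xi>'\<bar>"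
        using \<theta> x z by (intro mult_right_mono mult_left_mono) (auto simp: L_def)
      finally have "ennreal \<bar>e 0 x - d 0 x\<bar> \<le> ennreal (\<theta> * L * \<bar>d 1 \<xi> - d 1 \<xi>'\<bar>)"
        by (rule ennreal_leI)
      also have "\<dots> = ennreal (\<theta> * L) * ennreal \<bar>d 1 \<xi> - d 1 \<xi>'\<bar>"
        using \<theta> L by (simp add: ennreal_mult')
      also have "\<dots> \<le> ennreal (\<theta> * L) * W 2 x"
        unfolding W_def using \<xi> \<xi>' y y' H
        by (intro mult_left_mono increment_le_nn_integral[OF d1 c2]) auto
      finally show "ennreal \<bar>e 0 x - d 0 x\<bar> \<le> ennreal (\<theta> * L) *
          (\<integral>\<^sup>+t. ennreal \<bar>d 2 t\<bar> * indicator {a..b} t * indicator {x - H..x + H} t \<partial>lborel)"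
        by (simp add: W_def)
    qed
    then show ?thesis by (simp add: H_def power2_eq_square algebra_simps)
  qed
  show thesis
    using that[OF e] e_norm err1 err2 by (simp add: L_def)
qed

subsection \<open>Inclusions between the classes\<close>

text \<open>At the scale h = \<mu> / x the two terms of the Landau inequality balance: (q / x) x^m
  and x^(m-k) q x^(k-1) are both q x^(m-1). The factor \<mu> makes h admissible for every
  \<open>x \<ge> 1\<close>.\<close>

lemma landau_scaled:
  assumes m: "1 \<le> m" "m < k"
  obtains K where "0 \<le> K"
    and "\<And>f x q. tower k f \<Longrightarrow> 1 \<le> x \<Longrightarrow> norm1 (f 0) \<le> q / x \<Longrightarrow> norm1 (f k) \<le> q * x ^ (k - 1)
           \<Longrightarrow> norm1 (f m) \<le> K * q * x ^ (m - 1)"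
proof -
  obtain C where C: "1 \<le> C" and landau: "\<And>d h. tower k d \<Longrightarrow> 0 < h \<Longrightarrow> h \<le> (b - a) / 2 \<Longrightarrow>
           norm1 (d m) \<le> C * (norm1 (d 0) / h ^ m + h ^ (k - m) * norm1 (d k))"
    using landau[of m k] m by (auto simp: Suc_le_eq)
  define \<mu> where "\<mu> = min 1 ((b - a) / 2)"
  have \<mu>: "0 < \<mu>" "\<mu> \<le> 1" "\<mu> \<le> (b - a) / 2" using ab unfolding \<mu>_def
    by (simp_all only: min.cobounded1 min.cobounded2) simp
  show thesis
  proof (rule that)
    show "0 \<le> C * (1 / \<mu> ^ m + 1)" using C \<mu> by simp
    fix f x q
    assume f: "tower k f" and x: "1 \<le> x" and f0: "norm1 (f 0) \<le> q / x" and fk: "norm1 (f k) \<le> q * x ^ (k - 1)"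
    have "0 \<le> q / x" using f0 norm1_nonneg order_trans by blast
    then have q: "0 \<le> q" using x by (simp add: zero_le_divide_iff)
    have h: "0 < \<mu> / x" "\<mu> / x \<le> (b - a) / 2"
    proof -
      show "0 < \<mu> / x" using \<mu> x by simp
      have "\<mu> / x \<le> \<mu>" using \<mu> x by (simp add: field_simps mult_left_le)
      then show "\<mu> / x \<le> (b - a) / 2" using \<mu>(3) by (rule order_trans)
    qed
    have "norm1 (f 0) / (\<mu> / x) ^ m \<le> q / x / (\<mu> / x) ^ m"
      using f0 h by (intro divide_right_mono) auto
    also have "\<dots> = 1 / \<mu> ^ m * (q * (x ^ m / x))"
      by (simp add: field_simps power_divide)
    also have "x ^ m / x = x ^ (m - 1)"
      using m x by (simp add: power_diff)
    finally have 1: "norm1 (f 0) / (\<mu> / x) ^ m \<le> 1 / \<mu> ^ m * (q * x ^ (m - 1))" .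
    have "(\<mu> / x) ^ (k - m) * norm1 (f k) \<le> (1 / x) ^ (k - m) * (q * x ^ (k - 1))"
      using fk \<mu> x norm1_nonneg by (intro mult_mono power_mono) (auto simp: divide_right_mono)
    also have "x ^ (k - 1) = x ^ (k - m) * x ^ (m - 1)"
      using m by (simp flip: power_add)
    also have "(1 / x) ^ (k - m) * (q * (x ^ (k - m) * x ^ (m - 1))) = q * x ^ (m - 1)"
      using x by (simp add: field_simps)
    finally have 2: "(\<mu> / x) ^ (k - m) * norm1 (f k) \<le> q * x ^ (m - 1)" .
    have "norm1 (f m) \<le> C * (norm1 (f 0) / (\<mu> / x) ^ m + (\<mu> / x) ^ (k - m) * norm1 (f k))"
      by (rule landau[OF f h])
    also have "\<dots> \<le> C * (1 / \<mu> ^ m * (q * x ^ (m - 1)) + q * x ^ (m - 1))"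
      using C by (intro mult_left_mono add_mono 1 2) auto
    finally show "norm1 (f m) \<le> C * (1 / \<mu> ^ m + 1) * q * x ^ (m - 1)"
      by (simp add: algebra_simps)
  qed
qed

text \<open>A discrete Marchaud inequality: telescope near-optimal approximants over the scales
  \<open>lam / 2 ^ i\<close> and interpolate the \<open>m\<close>-th derivative of each difference.\<close>

lemma S_class_telescoping:
  assumes g: "g \<in> S_class k \<phi> a b" and \<phi>: "\<And>lam. 0 < lam \<Longrightarrow> 1 \<le> \<phi> lam"
    and mono: "mono_on {0<..} \<phi>" and m: "1 \<le> m" "m < k"
  obtains C where "0 \<le> C"
    and "\<And>lam. 1 \<le> lam \<Longrightarrow> \<exists>d n. tower k d \<and> 2 ^ n \<le> lam
           \<and> norm1 (d k) \<le> C * lam ^ (k - 1) * \<phi> lam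
           \<and> norm1 (\<lambda>x. d 0 x - g x) \<le> C * \<phi> lam / lam
           \<and> norm1 (d m) \<le> C * (\<Sum>i\<le>n. (lam / 2 ^ i) ^ (m - 1) * \<phi> (lam / 2 ^ i))"
proof -
  obtain C where C: "0 \<le> C" and ex: "\<And>lam. 0 < lam \<Longrightarrow> \<exists>d. tower k d \<and>
      norm1 (d k) \<le> C * lam ^ (k - 1) * \<phi> lam \<and> norm1 (\<lambda>x. d 0 x - g x) \<le> C * \<phi> lam / lam"
    using S_class_approximants[OF g \<phi>] by blast
  from ex obtain D where D: "\<And>lam. 0 < lam \<Longrightarrow> tower k (D lam)"
    and Dk: "\<And>lam. 0 < lam \<Longrightarrow> norm1 (D lam k) \<le> C * lam ^ (k - 1) * \<phi> lam"
    and D0: "\<And>lam. 0 < lam \<Longrightarrow> norm1 (\<lambda>x. D lam 0 x - g x) \<le> C * \<phi> lam / lam"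
    by metis
  have gL: "g \<in> L1 a b" using g by (simp add: S_class_def)
  obtain K where K: "0 \<le> K"
    and scaled: "\<And>f x q. tower k f \<Longrightarrow> 1 \<le> x \<Longrightarrow> norm1 (f 0) \<le> q / x \<Longrightarrow> norm1 (f k) \<le> q * x ^ (k - 1)
           \<Longrightarrow> norm1 (f m) \<le> K * q * x ^ (m - 1)"
    using landau_scaled[OF m] by blast
  \<comment> \<open>Between consecutive scales x and x/2 the errors C phi(x)/x and 2 C phi(x/2)/x
    add up to at most 3 C phi(x)/x. At the last scale \<open>g\<close> itself is the reference, and
    x < 2 with phi \<ge> 1 gives norm1 g \<le> 2 norm1 g phi(x)/x.\<close>
  define A where "A = 3 * C + 2 * norm1 g"
  have A: "0 \<le> A" "3 * C \<le> A" "C + 2 * norm1 g \<le> A" using C norm1_nonneg by (auto simp: A_def)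
  show thesis
  proof (rule that[of "C + K * A"])
    show "0 \<le> C + K * A" using C K A by simp
    fix lam :: real assume lam: "1 \<le> lam"
    then obtain n :: nat where n: "2 ^ n \<le> lam" "lam < 2 ^ Suc n"
      by (rule ex_dyadic_floor)
    define l where "l i = lam / 2 ^ i" for i :: nat
    have l_pos: "0 < l i" for i using lam by (simp add: l_def)
    have l_ge: "1 \<le> l i" if "i \<le> n" for i
    proof -
      have "(2::real) ^ i \<le> 2 ^ n" using that by simp
      then have "2 ^ i \<le> lam" using n by linarith
      then show ?thesis by (simp add: l_def)
    qed
    have l_Suc: "l (Suc i) = l i / 2" for i by (simp add: l_def)
    have \<phi>l: "1 \<le> \<phi> (l i)" for i using \<phi> l_pos by blast
    have \<phi>_Suc: "\<phi> (l (Suc i)) \<le> \<phi> (l i)" for i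
      using l_pos[of i] by (intro mono_onD[OF mono]) (auto simp: l_Suc)
    \<comment> \<open>The last summand is the approximant itself, not a difference, so that the sum
      telescopes exactly to \<open>D lam\<close>. All scales \<open>l i\<close> with
      \<open>i \<le> n\<close> are at least 1, as \<open>landau_scaled\<close> requires.\<close>
    define f where "f i = (if i < n then (\<lambda>j x. D (l i) j x - D (l (Suc i)) j x) else D (l i))" for i
    have f: "tower k (f i)" for i
      using D l_pos by (auto simp: f_def intro: tower_diff)
    have bound: "norm1 (f i m) \<le> K * A * (l i ^ (m - 1) * \<phi> (l i))" if i: "i \<le> n" for i
    proof -
      define x where "x = l i"
      define p where "p = \<phi> x"
      have x: "1 \<le> x" and p: "1 \<le> p" using l_ge[OF i] \<phi>l by (auto simp: x_def p_def)
      have g_diff: "norm1 (\<lambda>x. D (l j) 0 x - g x) \<le> C * \<phi> (l j) / l j" "(\<lambda>x. D (l j) 0 x - g x) \<in> L1 a b" for j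
        using D0[OF l_pos] tower_L1[OF D[OF l_pos]] gL by (auto intro: L1_diff)
      have "norm1 (f i 0) \<le> A * p / x \<and> norm1 (f i k) \<le> A * p * x ^ (k - 1)"
      proof (cases "i < n")
        case True
        have p': "\<phi> (x / 2) \<le> p" using \<phi>_Suc[of i] by (simp add: l_Suc x_def p_def)
        have "norm1 (f i 0) = norm1 (\<lambda>y. (D (l i) 0 y - g y) - (D (l (Suc i)) 0 y - g y))"
          using True by (simp add: f_def)
        also have "\<dots> \<le> C * \<phi> (l i) / l i + C * \<phi> (l (Suc i)) / l (Suc i)"
          by (intro order_trans[OF norm1_diff add_mono] g_diff)
        also have "\<dots> = C * p / x + 2 * (C * \<phi> (x / 2)) / x"
          by (simp add: l_Suc x_def p_def)
        also have "\<dots> \<le> C * p / x + 2 * (C * p) / x"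
          using x p' C by (intro add_left_mono divide_right_mono mult_left_mono) auto
        also have "\<dots> = 3 * C * p / x" by (simp add: field_simps)
        also have "\<dots> \<le> A * p / x"
          using A x p by (intro divide_right_mono mult_right_mono) auto
        finally have 1: "norm1 (f i 0) \<le> A * p / x" .
        have "norm1 (f i k) \<le> norm1 (D (l i) k) + norm1 (D (l (Suc i)) k)"
          using True by (auto simp: f_def intro!: norm1_diff tower_L1[OF D[OF l_pos]])
        also have "\<dots> \<le> C * x ^ (k - 1) * p + C * (x / 2) ^ (k - 1) * \<phi> (x / 2)"
          using Dk[OF l_pos, of i] Dk[OF l_pos, of "Suc i"] by (simp add: x_def p_def l_Suc)
        also have "C * (x / 2) ^ (k - 1) * \<phi> (x / 2) \<le> C * x ^ (k - 1) * p"
          using x p' C \<phi>[of "x / 2"] by (intro mult_mono power_mono) auto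
        also have "C * x ^ (k - 1) * p + C * x ^ (k - 1) * p = 2 * C * (p * x ^ (k - 1))"
          by simp
        also have "\<dots> \<le> A * (p * x ^ (k - 1))"
          using A C x p by (intro mult_right_mono) auto
        finally show ?thesis using 1 by (simp add: mult_ac)
      next
        case False
        then have "i = n" using i by simp
        then have x2: "x < 2" using n lam by (simp add: x_def l_def field_simps)
        have "norm1 (f i 0) = norm1 (\<lambda>y. (D (l i) 0 y - g y) + g y)"
          using False by (simp add: f_def)
        also have "\<dots> \<le> C * \<phi> (l i) / l i + norm1 g"
          by (intro order_trans[OF norm1_add add_mono] g_diff gL) simp
        also have "norm1 g \<le> 2 * norm1 g * p / x"
        proof -
          have "norm1 g * x \<le> norm1 g * (2 * p)"
            using norm1_nonneg x2 p by (intro mult_left_mono) auto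
          then show ?thesis using x by (simp add: field_simps)
        qed
        also have "C * \<phi> (l i) / l i + 2 * norm1 g * p / x = (C + 2 * norm1 g) * p / x"
          by (simp add: x_def p_def algebra_simps add_divide_distrib)
        also have "\<dots> \<le> A * p / x"
          using A x p by (intro divide_right_mono mult_right_mono) auto
        finally have 1: "norm1 (f i 0) \<le> A * p / x" by simp
        have "norm1 (f i k) \<le> C * (p * x ^ (k - 1))"
          using False Dk[OF l_pos, of i] by (simp add: f_def x_def p_def mult_ac)
        also have "\<dots> \<le> A * (p * x ^ (k - 1))"
          using A C x p by (intro mult_right_mono) auto
        finally show ?thesis using 1 by (simp add: mult_ac)
      qed
      then have "norm1 (f i m) \<le> K * (A * p) * x ^ (m - 1)"
        by (intro scaled[OF f x]) auto
      then show ?thesis by (simp add: x_def p_def mult_ac)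
    qed
    have "D lam m x = (\<Sum>i\<le>n. f i m x)" for x
    proof -
      have "(\<Sum>i\<le>n. f i m x) = (\<Sum>i<n. f i m x) + f n m x"
        by (simp flip: lessThan_Suc_atMost)
      also have "\<dots> = (\<Sum>i<n. D (l i) m x - D (l (Suc i)) m x) + D (l n) m x"
        by (simp add: f_def)
      also have "\<dots> = D (l 0) m x"
        by (subst sum_lessThan_telescope') simp
      finally show ?thesis by (simp add: l_def)
    qed
    then have "norm1 (D lam m) = norm1 (\<lambda>x. \<Sum>i\<le>n. f i m x)"
      by (intro norm1_cong) simp
    also have "\<dots> \<le> (\<Sum>i\<le>n. norm1 (f i m))"
      using m by (intro norm1_sum tower_L1[OF f]) auto
    also have "\<dots> \<le> (\<Sum>i\<le>n. K * A * (l i ^ (m - 1) * \<phi> (l i)))"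
      by (intro sum_mono bound) simp
    also have "\<dots> = K * A * (\<Sum>i\<le>n. l i ^ (m - 1) * \<phi> (l i))"
      by (simp add: sum_distrib_left)
    also have "\<dots> \<le> (C + K * A) * (\<Sum>i\<le>n. l i ^ (m - 1) * \<phi> (l i))"
      using C \<phi>l l_pos less_imp_le[OF l_pos] order_trans[OF zero_le_one \<phi>l]
      by (intro mult_right_mono sum_nonneg) auto
    finally have 3: "norm1 (D lam m) \<le> (C + K * A) * (\<Sum>i\<le>n. l i ^ (m - 1) * \<phi> (l i))" .
    have lam0: "0 < lam" and \<phi>lam: "0 \<le> \<phi> lam" using lam \<phi>[of lam] by auto
    have 1: "norm1 (D lam k) \<le> (C + K * A) * lam ^ (k - 1) * \<phi> lam"
      using K A lam \<phi>lam
      by (intro order_trans[OF Dk[OF lam0]] mult_right_mono) auto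
    have 2: "norm1 (\<lambda>x. D lam 0 x - g x) \<le> (C + K * A) * \<phi> lam / lam"
      using K A lam \<phi>lam
      by (intro order_trans[OF D0[OF lam0]] divide_right_mono mult_right_mono) auto
    show "\<exists>d n. tower k d \<and> 2 ^ n \<le> lam \<and> norm1 (d k) \<le> (C + K * A) * lam ^ (k - 1) * \<phi> lam
           \<and> norm1 (\<lambda>x. d 0 x - g x) \<le> (C + K * A) * \<phi> lam / lam
           \<and> norm1 (d m) \<le> (C + K * A) * (\<Sum>i\<le>n. (lam / 2 ^ i) ^ (m - 1) * \<phi> (lam / 2 ^ i))"
      using D[OF lam0] n(1) 1 2 3 unfolding l_def by blast
  qed
qed

text \<open>One and the same \<open>d\<close> has to satisfy all the bounds: raising the order
  smooths a \<open>d\<close> whose \<open>k\<close>-th derivative is controlled and measures the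
  error by its second derivative.\<close>

lemma S_class_intermediate:
  assumes g: "g \<in> S_class k \<phi> a b" and \<phi>: "\<And>lam. 0 < lam \<Longrightarrow> 1 \<le> \<phi> lam"
    and mono: "mono_on {0<..} \<phi>" and m: "2 \<le> m" "m \<le> k"
  obtains C where "0 \<le> C"
    and "\<And>lam. 1 \<le> lam \<Longrightarrow> \<exists>d. tower k d
           \<and> norm1 (d k) \<le> C * lam ^ (k - 1) * \<phi> lam
           \<and> norm1 (\<lambda>x. d 0 x - g x) \<le> C * \<phi> lam / lam
           \<and> norm1 (d m) \<le> C * lam ^ (m - 1) * \<phi> lam"
proof (cases "m = k")
  case True
  obtain C where C: "0 \<le> C" and ex: "\<And>lam. 0 < lam \<Longrightarrow> \<exists>d. tower k d \<and>
      norm1 (d k) \<le> C * lam ^ (k - 1) * \<phi> lam \<and> norm1 (\<lambda>x. d 0 x - g x) \<le> C * \<phi> lam / lam"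
    using S_class_approximants[OF g \<phi>] by blast
  have "\<exists>d. tower k d \<and> norm1 (d k) \<le> C * lam ^ (k - 1) * \<phi> lam
           \<and> norm1 (\<lambda>x. d 0 x - g x) \<le> C * \<phi> lam / lam
           \<and> norm1 (d m) \<le> C * lam ^ (m - 1) * \<phi> lam" if "1 \<le> lam" for lam
    using ex[of lam] that True by auto
  then show thesis using that[OF C] by blast
next
  case False
  obtain C where C: "0 \<le> C"
    and ex: "\<And>lam. 1 \<le> lam \<Longrightarrow> \<exists>d n. tower k d \<and> 2 ^ n \<le> lam
           \<and> norm1 (d k) \<le> C * lam ^ (k - 1) * \<phi> lam
           \<and> norm1 (\<lambda>x. d 0 x - g x) \<le> C * \<phi> lam / lam
           \<and> norm1 (d m) \<le> C * (\<Sum>i\<le>n. (lam / 2 ^ i) ^ (m - 1) * \<phi> (lam / 2 ^ i))"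
    using S_class_telescoping[OF g \<phi> mono, of m] m False by auto
  show thesis
  proof (rule that[of "2 * C"])
    show "0 \<le> 2 * C" using C by simp
    fix lam :: real assume lam: "1 \<le> lam"
    then have \<phi>lam: "0 \<le> \<phi> lam" using \<phi>[of lam] by simp
    obtain d n where d: "tower k d" "norm1 (d k) \<le> C * lam ^ (k - 1) * \<phi> lam"
      "norm1 (\<lambda>x. d 0 x - g x) \<le> C * \<phi> lam / lam"
      "norm1 (d m) \<le> C * (\<Sum>i\<le>n. (lam / 2 ^ i) ^ (m - 1) * \<phi> (lam / 2 ^ i))"
      using ex[OF lam] by blast
    have "(\<Sum>i\<le>n. (lam / 2 ^ i) ^ (m - 1) * \<phi> (lam / 2 ^ i))
        \<le> (\<Sum>i\<le>n. lam ^ (m - 1) * \<phi> lam * (1 / 2) ^ i)"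
    proof (rule sum_mono)
      fix i
      have l: "0 < lam / 2 ^ i" "lam / 2 ^ i \<le> lam" using lam by (auto simp: field_simps)
      have "\<phi> (lam / 2 ^ i) \<le> \<phi> lam"
        using l lam by (intro mono_onD[OF mono]) auto
      moreover have "(lam / 2 ^ i) ^ (m - 1) \<le> lam ^ (m - 1) * (1 / 2) ^ i"
      proof -
        \<comment> \<open>Here \<open>m \<ge> 2\<close> enters: the exponent \<open>m - 1\<close> is
          at least 1, which makes the sum geometric with ratio at most 1/2.\<close>
        have "((1 / 2) ^ i) ^ (m - 1) \<le> ((1 / 2 :: real) ^ i) ^ 1"
          using m by (intro power_decreasing) (auto simp: power_le_one)
        then have "lam ^ (m - 1) * ((1 / 2) ^ i) ^ (m - 1) \<le> lam ^ (m - 1) * (1 / 2) ^ i"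
          using lam by (intro mult_left_mono) auto
        then show ?thesis by (simp add: power_divide)
      qed
      ultimately have "(lam / 2 ^ i) ^ (m - 1) * \<phi> (lam / 2 ^ i) \<le> lam ^ (m - 1) * (1 / 2) ^ i * \<phi> lam"
        using \<phi>[OF l(1)] lam by (intro mult_mono) auto
      then show "(lam / 2 ^ i) ^ (m - 1) * \<phi> (lam / 2 ^ i) \<le> lam ^ (m - 1) * \<phi> lam * (1 / 2) ^ i"
        by (simp add: mult_ac)
    qed
    also have "\<dots> = lam ^ (m - 1) * \<phi> lam * (\<Sum>i\<le>n. (1 / 2) ^ i)"
      by (simp add: sum_distrib_left)
    also have "(\<Sum>i\<le>n. (1 / 2 :: real) ^ i) \<le> 2"
      by (subst sum_gp0) simp
    finally have "(\<Sum>i\<le>n. (lam / 2 ^ i) ^ (m - 1) * \<phi> (lam / 2 ^ i)) \<le> lam ^ (m - 1) * \<phi> lam * 2"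
      using lam \<phi>lam by (simp add: mult_left_mono)
    then have "norm1 (d m) \<le> C * (lam ^ (m - 1) * \<phi> lam * 2)"
      using d(4) C by (meson mult_left_mono order_trans)
    moreover have "C * lam ^ (k - 1) * \<phi> lam \<le> 2 * C * lam ^ (k - 1) * \<phi> lam"
      using C lam \<phi>lam by (intro mult_right_mono) auto
    moreover have "C * \<phi> lam / lam \<le> 2 * C * \<phi> lam / lam"
      using C lam \<phi>lam by (intro divide_right_mono mult_right_mono) auto
    ultimately have "norm1 (d m) \<le> 2 * C * lam ^ (m - 1) * \<phi> lam"
        "norm1 (d k) \<le> 2 * C * lam ^ (k - 1) * \<phi> lam"
        "norm1 (\<lambda>x. d 0 x - g x) \<le> 2 * C * \<phi> lam / lam"
      using d(2,3) by (simp_all add: mult_ac)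
    then show "\<exists>d. tower k d \<and> norm1 (d k) \<le> 2 * C * lam ^ (k - 1) * \<phi> lam
           \<and> norm1 (\<lambda>x. d 0 x - g x) \<le> 2 * C * \<phi> lam / lam
           \<and> norm1 (d m) \<le> 2 * C * lam ^ (m - 1) * \<phi> lam"
      using d(1) by blast
  qed
qed

lemma S_class_antimono:
  assumes \<phi>: "\<And>lam. 0 < lam \<Longrightarrow> 1 \<le> \<phi> lam" and mono: "mono_on {0<..} \<phi>"
    and m: "2 \<le> m" "m \<le> k"
  shows "S_class k \<phi> a b \<subseteq> S_class m \<phi> a b"
proof
  fix g assume g: "g \<in> S_class k \<phi> a b"
  then have gL: "g \<in> L1 a b" by (simp add: S_class_def)
  obtain C where C: "0 \<le> C"
    and ex: "\<And>lam. 1 \<le> lam \<Longrightarrow> \<exists>d. tower k d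
           \<and> norm1 (d k) \<le> C * lam ^ (k - 1) * \<phi> lam
           \<and> norm1 (\<lambda>x. d 0 x - g x) \<le> C * \<phi> lam / lam
           \<and> norm1 (d m) \<le> C * lam ^ (m - 1) * \<phi> lam"
    using S_class_intermediate[OF g \<phi> mono m] by blast
  show "g \<in> S_class m \<phi> a b"
    by (rule S_classI[OF gL \<phi> C]) (use ex tower_mono m in blast)+
qed

text \<open>For \<open>m = 1\<close> the powers in the telescoped bound are 1, and a partial sum of
  \<open>hat\<close> is left: \<open>2 ^ n \<le> lam\<close> puts \<open>n\<close> within its range,
  and further terms are nonnegative. The term i = 0 gives \<phi> \<le> \<open>hat \<phi>\<close>,
  which transfers the distance bound and the lower bound 1 to the new weight.\<close>

lemma S_class_2_subset_hat:
  assumes \<phi>: "\<And>lam. 0 < lam \<Longrightarrow> 1 \<le> \<phi> lam" and mono: "mono_on {0<..} \<phi>"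
  shows "S_class 2 \<phi> a b \<subseteq> S_class 1 (hat \<phi>) a b"
proof
  fix g assume g: "g \<in> S_class 2 \<phi> a b"
  then have gL: "g \<in> L1 a b" by (simp add: S_class_def)
  obtain C where C: "0 \<le> C"
    and ex: "\<And>lam. 1 \<le> lam \<Longrightarrow> \<exists>d n. tower 2 d \<and> 2 ^ n \<le> lam
           \<and> norm1 (d 2) \<le> C * lam ^ (2 - 1) * \<phi> lam
           \<and> norm1 (\<lambda>x. d 0 x - g x) \<le> C * \<phi> lam / lam
           \<and> norm1 (d 1) \<le> C * (\<Sum>i\<le>n. (lam / 2 ^ i) ^ (1 - 1) * \<phi> (lam / 2 ^ i))"
    using S_class_telescoping[OF g \<phi> mono, of 1] by auto
  have \<phi>_pos: "0 \<le> \<phi> (lam / 2 ^ i)" if "0 < lam" for lam and i :: nat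
    using \<phi>[of "lam / 2 ^ i"] that by simp
  have sum_le_hat: "(\<Sum>i\<le>n. \<phi> (lam / 2 ^ i)) \<le> hat \<phi> lam" if "0 < lam" "2 ^ n \<le> 1 + lam" for lam n
  proof -
    have "real n \<le> log 2 (1 + lam)"
      using that by (intro le_log_of_power) auto
    then have "n \<le> nat \<lfloor>log 2 (1 + lam)\<rfloor>"
      by (simp add: le_nat_floor)
    then show ?thesis
      unfolding hat_def using \<phi>_pos[OF \<open>0 < lam\<close>] by (intro sum_mono2) auto
  qed
  have \<phi>_le_hat: "\<phi> lam \<le> hat \<phi> lam" if "0 < lam" for lam
    using sum_le_hat[OF that, of 0] that by simp
  show "g \<in> S_class 1 (hat \<phi>) a b"
  proof (rule S_classI[OF gL _ C])
    fix lam :: real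
    show "1 \<le> hat \<phi> lam" if "0 < lam"
      using \<phi>_le_hat[OF that] \<phi>[OF that] by simp
    assume lam: "1 \<le> lam"
    obtain d n where d: "tower 2 d" "2 ^ n \<le> lam" "norm1 (\<lambda>x. d 0 x - g x) \<le> C * \<phi> lam / lam"
      "norm1 (d 1) \<le> C * (\<Sum>i\<le>n. \<phi> (lam / 2 ^ i))"
      using ex[OF lam] by auto
    have "norm1 (d 1) \<le> C * hat \<phi> lam"
      using d(2,4) C lam sum_le_hat[of lam n] by (meson mult_left_mono order_trans add_increasing zero_le_one less_le_trans zero_less_one)
    moreover have "C * \<phi> lam / lam \<le> C * hat \<phi> lam / lam"
      using C lam \<phi>_le_hat[of lam] by (intro divide_right_mono mult_left_mono) auto
    ultimately show "\<exists>d. tower 1 d \<and> norm1 (d 1) \<le> C * lam ^ (1 - 1) * hat \<phi> lam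
           \<and> norm1 (\<lambda>x. d 0 x - g x) \<le> C * hat \<phi> lam / lam"
      using d(1,3) tower_mono[of 2 d 1] by (intro exI[of _ d]) auto
  qed
qed

text \<open>Smoothing at \<theta> = 1 / (4 lam), which is at most 1/4 for
  \<open>lam \<ge> 1\<close>, multiplies the derivative bound by 20 lam / L and adds an error of the
  order phi(lam) / lam.\<close>

lemma S_class_Suc:
  assumes \<phi>: "\<And>lam. 0 < lam \<Longrightarrow> 1 \<le> \<phi> lam" and mono: "mono_on {0<..} \<phi>" and k: "1 \<le> k"
  shows "S_class k \<phi> a b \<subseteq> S_class (Suc k) \<phi> a b"
proof
  fix g assume g: "g \<in> S_class k \<phi> a b"
  then have gL: "g \<in> L1 a b" by (simp add: S_class_def)
  define L where "L = b - a"
  have L: "0 < L" using ab by (simp add: L_def)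
  \<comment> \<open>The two summands are the error constants of the two cases at \<theta> = 1 / (4
    lam): 8 \<theta> L = 2 L / lam for \<open>k = 1\<close>, and 4 (\<theta> L)^2 lam = L^2 / (4
    lam) for \<open>k \<ge> 2\<close>.\<close>
  define B where "B = 2 * L + L\<^sup>2 / 4"
  \<comment> \<open>For \<open>k = 1\<close> the smoothing error is charged to \<open>d 1\<close>,
    which is \<open>d k\<close>; for larger \<open>k\<close> to \<open>d 2\<close>, whose bound
    comes from \<open>S_class_intermediate\<close>.\<close>
  have "\<exists>C\<ge>0. \<forall>lam\<ge>1. \<exists>d. tower k d
           \<and> norm1 (d k) \<le> C * lam ^ (k - 1) * \<phi> lam
           \<and> norm1 (\<lambda>x. d 0 x - g x) \<le> C * \<phi> lam / lam
           \<and> (k = 1 \<or> 2 \<le> k \<and> norm1 (d 2) \<le> C * lam * \<phi> lam)"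
  proof (cases "k = 1")
    case True
    obtain C where "0 \<le> C" and "\<And>lam. 0 < lam \<Longrightarrow> \<exists>d. tower k d \<and>
        norm1 (d k) \<le> C * lam ^ (k - 1) * \<phi> lam \<and> norm1 (\<lambda>x. d 0 x - g x) \<le> C * \<phi> lam / lam"
      using S_class_approximants[OF g \<phi>] by blast
    then show ?thesis using True by (intro exI[of _ C]) auto
  next
    case False
    then have "2 \<le> k" using k by simp
    obtain C where "0 \<le> C"
      and "\<And>lam. 1 \<le> lam \<Longrightarrow> \<exists>d. tower k d
           \<and> norm1 (d k) \<le> C * lam ^ (k - 1) * \<phi> lam
           \<and> norm1 (\<lambda>x. d 0 x - g x) \<le> C * \<phi> lam / lam
           \<and> norm1 (d 2) \<le> C * lam ^ (2 - 1) * \<phi> lam"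
      using S_class_intermediate[OF g \<phi> mono order_refl \<open>2 \<le> k\<close>] by blast
    then show ?thesis using \<open>2 \<le> k\<close> by (intro exI[of _ C]) auto
  qed
  then obtain C where C: "0 \<le> C"
    and ex: "\<And>lam. 1 \<le> lam \<Longrightarrow> \<exists>d. tower k d
           \<and> norm1 (d k) \<le> C * lam ^ (k - 1) * \<phi> lam
           \<and> norm1 (\<lambda>x. d 0 x - g x) \<le> C * \<phi> lam / lam
           \<and> (k = 1 \<or> 2 \<le> k \<and> norm1 (d 2) \<le> C * lam * \<phi> lam)"
    by blast
  \<comment> \<open>\<open>20 / L\<close> serves the new derivative; \<open>B + 1\<close> serves the
    distance to \<open>g\<close>, as smoothing error plus old distance.\<close>
  define C' where "C' = (20 / L + B + 1) * C"
  have C': "0 \<le> C'" "20 / L * C \<le> C'" "B * C + C \<le> C'"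
  proof -
    have "0 \<le> B" "0 \<le> B * C" "0 \<le> 20 / L" "0 \<le> 20 / L * C" using C L by (simp_all add: B_def)
    then show "0 \<le> C'" "20 / L * C \<le> C'" "B * C + C \<le> C'"
      using C unfolding C'_def distrib_right by simp_all
  qed
  show "g \<in> S_class (Suc k) \<phi> a b"
  proof (rule S_classI[OF gL \<phi> C'(1)])
    fix lam :: real assume lam: "1 \<le> lam"
    define p where "p = \<phi> lam"
    have p: "0 \<le> p" using \<phi>[of lam] lam by (simp add: p_def)
    obtain d where d: "tower k d" "norm1 (d k) \<le> C * lam ^ (k - 1) * p"
      "norm1 (\<lambda>x. d 0 x - g x) \<le> C * p / lam" "k = 1 \<or> 2 \<le> k \<and> norm1 (d 2) \<le> C * lam * p"
      using ex[OF lam] by (auto simp: p_def)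
    define \<theta> where "\<theta> = 1 / (4 * lam)"
    have \<theta>: "0 < \<theta>" "\<theta> \<le> 1 / 4" using lam by (auto simp: \<theta>_def field_simps)
    obtain e where e: "tower (Suc k) e"
      "norm1 (e (Suc k)) \<le> 5 / (\<theta> * L) * norm1 (d k)"
      "norm1 (\<lambda>x. e 0 x - d 0 x) \<le> 8 * (\<theta> * L) * norm1 (d 1)"
      "2 \<le> k \<Longrightarrow> norm1 (\<lambda>x. e 0 x - d 0 x) \<le> 4 * (\<theta> * L)\<^sup>2 * norm1 (d 2)"
      unfolding L_def using smoothing[OF d(1) k \<theta>] by blast
    have "norm1 (e (Suc k)) \<le> 5 / (\<theta> * L) * (C * lam ^ (k - 1) * p)"
      using d(2) \<theta> L by (intro order_trans[OF e(2)] mult_left_mono) auto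
    also have "\<dots> = 20 / L * C * (lam * lam ^ (k - 1)) * p"
      using lam L by (simp add: \<theta>_def field_simps)
    also have "lam * lam ^ (k - 1) = lam ^ (Suc k - 1)"
      using k by (simp flip: power_Suc)
    also have "20 / L * C * lam ^ (Suc k - 1) * p \<le> C' * lam ^ (Suc k - 1) * p"
      using C' lam p by (intro mult_right_mono) auto
    finally have 1: "norm1 (e (Suc k)) \<le> C' * lam ^ (Suc k - 1) * p" .
    have "norm1 (\<lambda>x. e 0 x - d 0 x) \<le> B * (C * p / lam)"
    proof (cases "k = 1")
      case True
      have "norm1 (\<lambda>x. e 0 x - d 0 x) \<le> 8 * (\<theta> * L) * (C * p)"
        using d(2) \<theta> L True by (intro order_trans[OF e(3)] mult_left_mono) auto
      also have "\<dots> = 2 * L * (C * p / lam)"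
        using lam by (simp add: \<theta>_def field_simps)
      also have "\<dots> \<le> B * (C * p / lam)"
        using C p lam by (intro mult_right_mono) (auto simp: B_def)
      finally show ?thesis .
    next
      case False
      then have "2 \<le> k" "norm1 (d 2) \<le> C * lam * p" using d(4) by auto
      then have "norm1 (\<lambda>x. e 0 x - d 0 x) \<le> 4 * (\<theta> * L)\<^sup>2 * (C * lam * p)"
        by (intro order_trans[OF e(4)] mult_left_mono) auto
      also have "\<dots> = L\<^sup>2 / 4 * (C * p / lam)"
        using lam by (simp add: \<theta>_def field_simps power2_eq_square)
      also have "\<dots> \<le> B * (C * p / lam)"
        using C p lam L by (intro mult_right_mono) (auto simp: B_def)
      finally show ?thesis .
    qed
    moreover have "norm1 (\<lambda>x. (e 0 x - d 0 x) + (d 0 x - g x))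
        \<le> norm1 (\<lambda>x. e 0 x - d 0 x) + norm1 (\<lambda>x. d 0 x - g x)"
      by (intro norm1_add L1_diff tower_L1[OF e(1)] tower_L1[OF d(1)] gL) auto
    ultimately have "norm1 (\<lambda>x. e 0 x - g x) \<le> B * (C * p / lam) + C * p / lam"
      using d(3) by simp
    also have "\<dots> = (B * C + C) * p / lam"
      using lam by (simp add: field_simps)
    also have "\<dots> \<le> C' * p / lam"
      using C' p lam by (intro divide_right_mono mult_right_mono) auto
    finally show "\<exists>d. tower (Suc k) d \<and> norm1 (d (Suc k)) \<le> C' * lam ^ (Suc k - 1) * \<phi> lam
           \<and> norm1 (\<lambda>x. d 0 x - g x) \<le> C' * \<phi> lam / lam"
      using e(1) 1 by (auto simp: p_def)
  qed
qed

lemma S_class_eq_S_class_2: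
  assumes \<phi>: "\<And>lam. 0 < lam \<Longrightarrow> 1 \<le> \<phi> lam" and mono: "mono_on {0<..} \<phi>" and "2 \<le> k"
  shows "S_class k \<phi> a b = S_class 2 \<phi> a b"
proof
  show "S_class k \<phi> a b \<subseteq> S_class 2 \<phi> a b"
    using S_class_antimono[OF \<phi> mono order_refl \<open>2 \<le> k\<close>] .
  show "S_class 2 \<phi> a b \<subseteq> S_class k \<phi> a b"
    using \<open>2 \<le> k\<close>
  proof (induction k rule: nat_induct_at_least)
    case (Suc n)
    then show ?case using S_class_Suc[OF \<phi> mono, of n] by auto
  qed simp
qed

subsection \<open>The Sobolev-type bound\<close>

abbreviation ioo :: "real \<Rightarrow> ennreal" where "ioo \<equiv> indicator {a<..<b}"

text \<open>The D(h) of the overview. The two indicators keep only those x for which both x and x +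
  h lie in (a,b).\<close>

definition translation_modulus :: "(real \<Rightarrow> real) \<Rightarrow> real \<Rightarrow> ennreal" where
  "translation_modulus g h = (\<integral>\<^sup>+x. ennreal \<bar>g (x + h) - g x\<bar> * ioo x * ioo (x + h) \<partial>lborel)"

text \<open>For a competitor \<gamma>, the increment of \<open>g'\<close> is at most the increment
  of \<gamma> plus the errors at x and x + h. Integration gives D(h) \<le> 2 \<open>n0\<close> + h
  \<open>n1\<close>, the window [x, x + h] having length h. The Borel function \<open>g'\<close>
  stands in for \<open>g\<close> because the double integral is treated by Tonelli on Borel
  functions.\<close>

lemma translation_modulus_le_M_fun:
  assumes g: "g \<in> L1 a b" and g' [measurable]: "g' \<in> borel_measurable borel"
    and AE_eq: "AE x in lborel. x \<in> {a<..<b} \<longrightarrow> g x = g' x" and h: "0 < h"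
  shows "ennreal (1 / (2 * h)) * translation_modulus g' h \<le> M_fun 1 a b g (1 / h)"
  unfolding M_fun_def
proof (rule INF_greatest)
  fix \<gamma> assume \<gamma>: "\<gamma> \<in> Ck 1 a b"
  define d where "d j = nth_deriv a b j \<gamma>" for j
  have d: "tower 1 d" unfolding d_def by (rule Ck_tower[OF \<gamma>])
  have d0: "d 0 = \<gamma>" by (simp add: d_def)
  define U where "U t = ennreal \<bar>d 0 t - g' t\<bar> * ioo t" for t
  define V where "V t = ennreal \<bar>d 1 t\<bar> * indicator {a..b} t" for t
  define n0 where "n0 = norm1 (\<lambda>x. d 0 x - g x)"
  define n1 where "n1 = norm1 (d 1)"
  have n: "0 \<le> n0" "0 \<le> n1" by (simp_all add: n0_def n1_def norm1_nonneg)
  have V_meas [measurable]: "V \<in> borel_measurable borel"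
    unfolding V_def by (intro borel_measurable_continuous_Icc tower_continuous[OF d]) simp
  have U_meas [measurable]: "U \<in> borel_measurable borel"
  proof -
    have "(\<lambda>x. indicator {a<..<b} x *\<^sub>R d 0 x) \<in> borel_measurable borel"
      by (intro borel_measurable_continuous_on_indicator continuous_on_subset[OF tower_continuous[OF d, of 0]])
        auto
    then have "(\<lambda>t. ennreal \<bar>indicator {a<..<b} t *\<^sub>R d 0 t - g' t\<bar> * ioo t) \<in> borel_measurable borel"
      by measurable
    moreover have "(\<lambda>t. ennreal \<bar>indicator {a<..<b} t *\<^sub>R d 0 t - g' t\<bar> * ioo t) = U"
      by (auto simp: U_def indicator_def fun_eq_iff)
    ultimately show ?thesis by metis
  qed
  have U_int: "(\<integral>\<^sup>+t. U t \<partial>lborel) = ennreal n0"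
  proof -
    have "(\<integral>\<^sup>+t. U t \<partial>lborel) = (\<integral>\<^sup>+t. ennreal \<bar>d 0 t - g t\<bar> * ioo t \<partial>lborel)"
      using AE_eq by (intro nn_integral_cong_AE) (auto simp: U_def indicator_def elim: eventually_mono)
    also have "\<dots> = ennreal n0"
      using nn_integral_norm1[OF L1_diff[OF tower_L1[OF d] g], of 0]
      by (simp add: n0_def nn_integral_lebesgue_on)
    finally show ?thesis .
  qed
  have V_int: "(\<integral>\<^sup>+t. V t \<partial>lborel) = ennreal n1"
    unfolding V_def n1_def by (intro nn_integral_Icc_norm1 tower_L1[OF d order_refl])
  have "translation_modulus g' h
      \<le> (\<integral>\<^sup>+x. U (h + 1 * x) + (\<integral>\<^sup>+t. V t * indicator {x - 0..x + h} t \<partial>lborel) + U x \<partial>lborel)"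
    unfolding translation_modulus_def
  proof (rule nn_integral_mono)
    fix x
    show "ennreal \<bar>g' (x + h) - g' x\<bar> * ioo x * ioo (x + h)
        \<le> U (h + 1 * x) + (\<integral>\<^sup>+t. V t * indicator {x - 0..x + h} t \<partial>lborel) + U x"
    proof (cases "x \<in> {a<..<b} \<and> x + h \<in> {a<..<b}")
      case True
      have "ennreal \<bar>d 0 (x + h) - d 0 x\<bar> \<le> (\<integral>\<^sup>+t. V t * indicator {x - 0..x + h} t \<partial>lborel)"
        unfolding V_def
        by (rule increment_le_nn_integral)
           (use tower_deriv[OF d, of 0] tower_continuous[OF d, of 1] True h in auto)
      moreover have "ennreal \<bar>g' (x + h) - g' x\<bar>
          \<le> ennreal \<bar>d 0 (x + h) - g' (x + h)\<bar> + ennreal \<bar>d 0 (x + h) - d 0 x\<bar> + ennreal \<bar>d 0 x - g' x\<bar>"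
        by (simp flip: ennreal_plus)
      ultimately show ?thesis
        using True by (auto simp: U_def add.commute[of h] elim!: order_trans intro!: add_mono)
    qed auto
  qed
  also have "\<dots> = (\<integral>\<^sup>+x. U (h + 1 * x) \<partial>lborel)
      + (\<integral>\<^sup>+x. (\<integral>\<^sup>+t. V t * indicator {x - 0..x + h} t \<partial>lborel) \<partial>lborel) + (\<integral>\<^sup>+x. U x \<partial>lborel)"
  proof -
    define W where "W x = (\<integral>\<^sup>+t. V t * indicator {x - 0..x + h} t \<partial>lborel)" for x
    have [measurable]: "W \<in> borel_measurable borel"
      unfolding W_def by (simp add: indicator_def, measurable)
    show ?thesis
      unfolding W_def[symmetric] by (simp add: nn_integral_add)
  qed
  also have "(\<integral>\<^sup>+x. U (h + 1 * x) \<partial>lborel) = ennreal n0"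
    using nn_integral_real_affine[of U 1 h] U_int by simp
  also have "(\<integral>\<^sup>+x. (\<integral>\<^sup>+t. V t * indicator {x - 0..x + h} t \<partial>lborel) \<partial>lborel) = ennreal h * ennreal n1"
    using nn_integral_window[OF V_meas, of 0 h] h V_int by simp
  also have "ennreal n0 + ennreal h * ennreal n1 + (\<integral>\<^sup>+x. U x \<partial>lborel) = ennreal (n0 + h * n1 + n0)"
    using n h
    by (simp only: U_int ennreal_plus ennreal_mult' mult_nonneg_nonneg add_nonneg_nonneg less_imp_le)
  finally have "ennreal (1 / (2 * h)) * translation_modulus g' h \<le> ennreal (1 / (2 * h)) * ennreal (n0 + h * n1 + n0)"
    by (rule mult_left_mono) simp
  also have "\<dots> = ennreal (1 / (2 * h) * (n0 + h * n1 + n0))"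
    using h by (subst ennreal_mult') auto
  \<comment> \<open>The left side is n1 / 2 + n0 / h: the factor 2 is dictated by the two error
    terms.\<close>
  also have "\<dots> \<le> ennreal (n1 + 1 / h * n0)"
    using n h by (intro ennreal_leI) (simp add: field_simps)
  also have "\<dots> = F_fun 1 a b g (1 / h) \<gamma>"
    using F_fun_tower[OF d g, of "1 / h"] h by (simp add: d0 n0_def n1_def)
  finally show "ennreal (1 / (2 * h)) * translation_modulus g' h \<le> F_fun 1 a b g (1 / h) \<gamma>" .
qed

text \<open>The kernel is symmetric, so the integral is twice that over x < y. There y = x + h, and
  Tonelli moves the integration in h outside.\<close>

lemma W_integral_borel:
  assumes [measurable]: "g \<in> borel_measurable borel" "\<psi> \<in> borel_measurable borel"
  shows "(\<integral>\<^sup>+y. (\<integral>\<^sup>+x. ennreal (\<bar>g y - g x\<bar> / (\<bar>y - x\<bar> * \<psi> \<bar>y - x\<bar>)) * ioo x \<partial>lborel) * ioo y \<partial>lborel)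
    = 2 * (\<integral>\<^sup>+h. ennreal (1 / (h * \<psi> h)) * translation_modulus g h * indicator {0<..<b - a} h \<partial>lborel)"
proof -
  define K where "K x y = ennreal (\<bar>g y - g x\<bar> / (\<bar>y - x\<bar> * \<psi> \<bar>y - x\<bar>)) * ioo x * ioo y" for x y
  have K_meas [measurable]: "(\<lambda>p. K (fst p) (snd p)) \<in> borel_measurable (borel \<Otimes>\<^sub>M borel)"
    unfolding K_def by measurable
  have K_sym: "K x y = K y x" for x y
    by (simp add: K_def abs_minus_commute mult_ac)
  have K_diag: "K x x = 0" for x
    by (simp add: K_def)
  \<comment> \<open>The diagonal may be dropped from both halves, as \<open>K\<close> vanishes
    there.\<close>
  define T where "T x y = K x y * (if x < y then 1 else 0)" for x y
  have T_meas [measurable]: "(\<lambda>p. T (fst p) (snd p)) \<in> borel_measurable (borel \<Otimes>\<^sub>M borel)"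
    unfolding T_def by measurable
  have T_meas1 [measurable]: "T x \<in> borel_measurable borel" "(\<lambda>x. T x y) \<in> borel_measurable borel" for x y
    using measurable_compose[OF measurable_Pair1' T_meas, of x] measurable_compose[OF measurable_Pair2' T_meas, of y]
    by (auto simp: space_borel)
  have split: "K x y = T x y + T y x" for x y
    using K_sym[of x y] K_diag by (cases x y rule: linorder_cases) (auto simp: T_def)
  have "(\<integral>\<^sup>+y. (\<integral>\<^sup>+x. ennreal (\<bar>g y - g x\<bar> / (\<bar>y - x\<bar> * \<psi> \<bar>y - x\<bar>)) * ioo x \<partial>lborel) * ioo y \<partial>lborel)
      = (\<integral>\<^sup>+y. (\<integral>\<^sup>+x. T x y + T y x \<partial>lborel) \<partial>lborel)"
    unfolding split[symmetric] K_def
    by (intro nn_integral_cong nn_integral_multc[symmetric]) measurable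
  also have "\<dots> = (\<integral>\<^sup>+y. (\<integral>\<^sup>+x. T x y \<partial>lborel) \<partial>lborel) + (\<integral>\<^sup>+y. (\<integral>\<^sup>+x. T y x \<partial>lborel) \<partial>lborel)"
  proof -
    have "(\<integral>\<^sup>+x. T x y + T y x \<partial>lborel) = (\<integral>\<^sup>+x. T x y \<partial>lborel) + (\<integral>\<^sup>+x. T y x \<partial>lborel)" for y
      by (rule nn_integral_add) measurable
    moreover have "(\<lambda>y. \<integral>\<^sup>+x. T x y \<partial>lborel) \<in> borel_measurable lborel"
      "(\<lambda>y. \<integral>\<^sup>+x. T y x \<partial>lborel) \<in> borel_measurable lborel"
      unfolding T_def K_def by measurable
    ultimately show ?thesis by (simp add: nn_integral_add)
  qed
  also have "(\<integral>\<^sup>+y. (\<integral>\<^sup>+x. T x y \<partial>lborel) \<partial>lborel) = (\<integral>\<^sup>+x. (\<integral>\<^sup>+y. T x y \<partial>lborel) \<partial>lborel)"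
    by (rule lborel_pair.Fubini') (simp add: case_prod_unfold)
  also have "(\<integral>\<^sup>+x. (\<integral>\<^sup>+y. T x y \<partial>lborel) \<partial>lborel) + (\<integral>\<^sup>+x. (\<integral>\<^sup>+y. T x y \<partial>lborel) \<partial>lborel)
      = 2 * (\<integral>\<^sup>+x. (\<integral>\<^sup>+y. T x y \<partial>lborel) \<partial>lborel)"
    by (simp add: mult_2)
  also have "(\<integral>\<^sup>+x. (\<integral>\<^sup>+y. T x y \<partial>lborel) \<partial>lborel) = (\<integral>\<^sup>+x. (\<integral>\<^sup>+h. T x (x + 1 * h) \<partial>lborel) \<partial>lborel)"
  proof (rule nn_integral_cong)
    show "(\<integral>\<^sup>+y. T x y \<partial>lborel) = (\<integral>\<^sup>+h. T x (x + 1 * h) \<partial>lborel)" for x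
      using nn_integral_real_affine[of "T x" 1 x] by simp
  qed
  also have "\<dots> = (\<integral>\<^sup>+h. (\<integral>\<^sup>+x. T x (x + 1 * h) \<partial>lborel) \<partial>lborel)"
    unfolding T_def K_def by (rule lborel_pair.Fubini'[symmetric]) (simp add: case_prod_unfold)
  also have "\<dots> = (\<integral>\<^sup>+h. ennreal (1 / (h * \<psi> h)) * translation_modulus g h * indicator {0<..<b - a} h \<partial>lborel)"
  proof (rule nn_integral_cong)
    fix h
    \<comment> \<open>The indicator of (0, b - a) comes for free: for larger h the points x and x +
      h cannot both lie in (a,b).\<close>
    have "T x (x + 1 * h)
        = ennreal (1 / (h * \<psi> h)) * indicator {0<..<b - a} h * (ennreal \<bar>g (x + h) - g x\<bar> * ioo x * ioo (x + h))" for x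
    proof (cases "0 < h \<and> x \<in> {a<..<b} \<and> x + h \<in> {a<..<b}")
      case True
      then have "ennreal (\<bar>g (x + h) - g x\<bar> / (h * \<psi> h)) = ennreal \<bar>g (x + h) - g x\<bar> * ennreal (1 / (h * \<psi> h))"
        by (simp flip: ennreal_mult')
      with True show ?thesis
        by (simp add: T_def K_def mult_ac)
    qed (auto simp: T_def K_def indicator_def)
    then have "(\<integral>\<^sup>+x. T x (x + 1 * h) \<partial>lborel)
        = ennreal (1 / (h * \<psi> h)) * indicator {0<..<b - a} h * translation_modulus g h"
      unfolding translation_modulus_def by (simp only:) (rule nn_integral_cmult, measurable)
    then show "(\<integral>\<^sup>+x. T x (x + 1 * h) \<partial>lborel)
        = ennreal (1 / (h * \<psi> h)) * translation_modulus g h * indicator {0<..<b - a} h"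
      by (simp add: mult_ac)
  qed
  finally show ?thesis .
qed

text \<open>Borel representatives of \<open>g\<close> and \<psi> are needed for joint measurability
  of the kernel in the product. Since \<psi> is evaluated at |y - x|, its exceptional null set must
  be pulled back along a map depending on y.\<close>

lemma W_integral_le:
  assumes g: "g \<in> L1 a b" and \<psi>: "\<psi> \<in> borel_measurable (lebesgue_on {0<..})" and \<psi>_pos: "\<And>w. 0 < w \<Longrightarrow> 0 < \<psi> w"
  shows "W_integral \<psi> a b g
          \<le> 4 * (\<integral>\<^sup>+ w. M_fun 1 a b g (1 / w) / ennreal (\<psi> w) \<partial>lebesgue_on {0<..<b - a})"
proof -
  have "(\<lambda>x. indicator {a<..<b} x *\<^sub>R g x) \<in> borel_measurable lebesgue"
    using g unfolding L1_iff by (subst borel_measurable_restrict_space_iff[symmetric]) auto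
  then obtain g' where g' [measurable]: "g' \<in> borel_measurable borel"
    and "AE x in lborel. indicator {a<..<b} x *\<^sub>R g x = g' x"
    using completion_ex_borel_measurable_real[of _ lborel] by auto
  then have g'_eq: "AE x in lborel. x \<in> {a<..<b} \<longrightarrow> g x = g' x"
    by (auto elim: eventually_mono)
  have "(\<lambda>x. indicator {0<..} x *\<^sub>R \<psi> x) \<in> borel_measurable lebesgue"
    using \<psi> by (subst borel_measurable_restrict_space_iff[symmetric]) auto
  then obtain \<psi>' where \<psi>' [measurable]: "\<psi>' \<in> borel_measurable borel"
    and "AE x in lborel. indicator {0<..} x *\<^sub>R \<psi> x = \<psi>' x"
    using completion_ex_borel_measurable_real[of _ lborel] by auto
  then have \<psi>'_eq: "AE x in lborel. 0 < x \<longrightarrow> \<psi> x = \<psi>' x"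
    by (auto elim: eventually_mono)
  then obtain N where N: "N \<in> null_sets lborel" "\<And>x. x \<notin> N \<Longrightarrow> 0 < x \<Longrightarrow> \<psi> x = \<psi>' x"
    by (auto elim!: AE_E3)
  then have [measurable]: "N \<in> sets borel" by auto
  \<comment> \<open>Used for x - y and y - x, the two values of |y - x|: for every fixed y both
    preimages of \<open>N\<close> are null.\<close>
  have N_affine: "AE x in lborel. y + c * x \<notin> N" if "c \<noteq> 0" for y c
    using AE_not_in[OF N(1)] by (intro AE_borel_affine[OF that, of "\<lambda>x. x \<notin> N"]) auto
  have "W_integral \<psi> a b g
      = (\<integral>\<^sup>+y. (\<integral>\<^sup>+x. ennreal (\<bar>g y - g x\<bar> / (\<bar>y - x\<bar> * \<psi> \<bar>y - x\<bar>)) * ioo x \<partial>lborel) * ioo y \<partial>lborel)"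
    by (simp add: W_integral_def nn_integral_lebesgue_on)
  also have "\<dots> = (\<integral>\<^sup>+y. (\<integral>\<^sup>+x. ennreal (\<bar>g' y - g' x\<bar> / (\<bar>y - x\<bar> * \<psi>' \<bar>y - x\<bar>)) * ioo x \<partial>lborel) * ioo y \<partial>lborel)"
  proof (rule nn_integral_cong_AE, use g'_eq in eventually_elim)
    fix y assume y: "y \<in> {a<..<b} \<longrightarrow> g y = g' y"
    have N_minus: "AE x in lborel. y + - 1 * x \<notin> N"
      by (rule N_affine) simp
    have "AE x in lborel. ennreal (\<bar>g' y - g x\<bar> / (\<bar>y - x\<bar> * \<psi> \<bar>y - x\<bar>)) * ioo x
        = ennreal (\<bar>g' y - g' x\<bar> / (\<bar>y - x\<bar> * \<psi>' \<bar>y - x\<bar>)) * ioo x"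
      using g'_eq N_affine[of 1 "- y", OF one_neq_zero] N_minus
    proof eventually_elim
      case (elim x)
      have "\<psi> \<bar>y - x\<bar> = \<psi>' \<bar>y - x\<bar>" if "x \<noteq> y"
        using elim that by (intro N(2)) (auto simp: abs_if)
      then show ?case using elim(1) by (cases "x = y") (auto simp: indicator_def)
    qed
    then have "(\<integral>\<^sup>+x. ennreal (\<bar>g' y - g x\<bar> / (\<bar>y - x\<bar> * \<psi> \<bar>y - x\<bar>)) * ioo x \<partial>lborel)
        = (\<integral>\<^sup>+x. ennreal (\<bar>g' y - g' x\<bar> / (\<bar>y - x\<bar> * \<psi>' \<bar>y - x\<bar>)) * ioo x \<partial>lborel)"
      by (rule nn_integral_cong_AE)
    then show "(\<integral>\<^sup>+x. ennreal (\<bar>g y - g x\<bar> / (\<bar>y - x\<bar> * \<psi> \<bar>y - x\<bar>)) * ioo x \<partial>lborel) * ioo y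
        = (\<integral>\<^sup>+x. ennreal (\<bar>g' y - g' x\<bar> / (\<bar>y - x\<bar> * \<psi>' \<bar>y - x\<bar>)) * ioo x \<partial>lborel) * ioo y"
      using y by (cases "y \<in> {a<..<b}") auto
  qed
  also have "\<dots> = 2 * (\<integral>\<^sup>+h. ennreal (1 / (h * \<psi>' h)) * translation_modulus g' h * indicator {0<..<b - a} h \<partial>lborel)"
    by (rule W_integral_borel) measurable
  \<comment> \<open>The factor 2 is pulled out while the integrand is still visibly Borel. The
    comparison with \<open>M_fun\<close> is then by monotonicity alone, without measurability of
    \<open>M_fun\<close> in its parameter.\<close>
  also have "\<dots> = 2 * (\<integral>\<^sup>+h. 2 * (ennreal (1 / 2) * ennreal (1 / (h * \<psi>' h)) * translation_modulus g' h * indicator {0<..<b - a} h) \<partial>lborel)"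
  proof -
    have "2 * (ennreal (1 / 2) * c) = c" for c
    proof -
      have "ennreal 2 * ennreal (1 / 2) = ennreal (2 * (1 / 2))"
        by (rule ennreal_mult'[symmetric]) simp
      then have "2 * ennreal (1 / 2) = 1"
        by (simp only: ennreal_numeral) simp
      then show ?thesis by (simp only: mult_1 flip: mult.assoc)
    qed
    then show ?thesis by (simp add: mult.assoc)
  qed
  also have "\<dots> = 2 * (2 * (\<integral>\<^sup>+h. ennreal (1 / 2) * ennreal (1 / (h * \<psi>' h)) * translation_modulus g' h * indicator {0<..<b - a} h \<partial>lborel))"
    unfolding translation_modulus_def by (subst nn_integral_cmult) auto
  also have "\<dots> \<le> 2 * (2 * (\<integral>\<^sup>+h. M_fun 1 a b g (1 / h) / ennreal (\<psi> h) * indicator {0<..<b - a} h \<partial>lborel))"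
  proof (intro mult_left_mono nn_integral_mono_AE)
    show "AE h in lborel. ennreal (1 / 2) * ennreal (1 / (h * \<psi>' h)) * translation_modulus g' h * indicator {0<..<b - a} h
        \<le> M_fun 1 a b g (1 / h) / ennreal (\<psi> h) * indicator {0<..<b - a} h"
      using \<psi>'_eq
    proof eventually_elim
      case (elim h)
      show ?case
      proof (cases "h \<in> {0<..<b - a}")
        case True
        then have h: "0 < h" and eq: "\<psi>' h = \<psi> h" using elim by auto
        have "ennreal (1 / 2) * ennreal (1 / (h * \<psi>' h)) = ennreal (1 / 2 * (1 / (h * \<psi>' h)))"
          by (rule ennreal_mult'[symmetric]) simp
        also have "1 / 2 * (1 / (h * \<psi>' h)) = 1 / (2 * h) * inverse (\<psi> h)"
          by (simp add: eq field_simps)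
        also have "ennreal (1 / (2 * h) * inverse (\<psi> h)) = ennreal (1 / (2 * h)) * inverse (ennreal (\<psi> h))"
          using h \<psi>_pos[OF h] by (subst ennreal_mult') (auto simp: inverse_ennreal)
        finally have "ennreal (1 / 2) * ennreal (1 / (h * \<psi>' h)) * translation_modulus g' h
            = ennreal (1 / (2 * h)) * translation_modulus g' h * inverse (ennreal (\<psi> h))"
          by (simp add: mult_ac)
        also have "\<dots> \<le> M_fun 1 a b g (1 / h) * inverse (ennreal (\<psi> h))"
          by (intro mult_right_mono translation_modulus_le_M_fun[OF g g' g'_eq h]) simp
        finally show ?thesis using True by (simp add: divide_ennreal_def)
      qed simp
    qed
  qed simp_all
  also have "\<dots> = 4 * (\<integral>\<^sup>+ w. M_fun 1 a b g (1 / w) / ennreal (\<psi> w) \<partial>lebesgue_on {0<..<b - a})"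
    by (simp add: nn_integral_lebesgue_on flip: mult.assoc)
  finally show ?thesis .
qed

lemma S_class_1_subset_W_space:
  assumes g: "g \<in> S_class 1 \<phi> a b" and \<phi>: "\<And>lam. 0 < lam \<Longrightarrow> 1 \<le> \<phi> lam" and mono: "mono_on {0<..} \<phi>"
    and \<psi>: "\<psi> \<in> borel_measurable (lebesgue_on {0<..})" and \<psi>_pos: "\<And>w. 0 < w \<Longrightarrow> 0 < \<psi> w"
    and fin: "(\<integral>\<^sup>+ w. ennreal (\<phi> (1 / w) / \<psi> w) \<partial>lebesgue_on {0<..<b - a}) < \<infinity>"
  shows "g \<in> W_space \<psi> a b"
proof -
  have gL: "g \<in> L1 a b" using g by (simp add: S_class_def)
  obtain c where M_le: "\<And>lam. 0 < lam \<Longrightarrow> M_fun 1 a b g lam \<le> ennreal c * ennreal (\<phi> lam)"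
    using S_class_M_fun_le[OF g \<phi>] by blast
  \<comment> \<open>Measurability allows the constant \<open>c\<close> to leave the integral. It
    comes from monotonicity: w -> - phi(1/w) is nondecreasing on the positive half-line.\<close>
  have meas: "(\<lambda>w. ennreal (\<phi> (1 / w) / \<psi> w)) \<in> borel_measurable (lebesgue_on {0<..<b - a})"
  proof -
    have "mono_on {0<..} (\<lambda>w. - \<phi> (1 / w))"
      by (rule mono_onI) (auto intro!: mono_onD[OF mono] simp: field_simps)
    then have "(\<lambda>w. - \<phi> (1 / w)) \<in> borel_measurable (restrict_space borel {0<..})"
      by (rule borel_measurable_mono_on_fnc)
    then have "(\<lambda>w. indicator {0<..} w *\<^sub>R (- \<phi> (1 / w))) \<in> borel_measurable borel"
      by (subst borel_measurable_restrict_space_iff[symmetric]) auto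
    then have "(\<lambda>w. indicator {0<..} w *\<^sub>R (- \<phi> (1 / w))) \<in> borel_measurable lebesgue"
      by (simp add: measurable_completion)
    then have "(\<lambda>w. - \<phi> (1 / w)) \<in> borel_measurable (lebesgue_on {0<..})"
      by (subst borel_measurable_restrict_space_iff) auto
    then have "(\<lambda>w. - (- \<phi> (1 / w)) / \<psi> w) \<in> borel_measurable (lebesgue_on {0<..})"
      using \<psi> by measurable
    then have "(\<lambda>w. ennreal (\<phi> (1 / w) / \<psi> w)) \<in> borel_measurable (lebesgue_on {0<..})"
      by simp
    then show ?thesis by (rule measurable_restrict_mono) auto
  qed
  have "W_integral \<psi> a b g \<le> 4 * (\<integral>\<^sup>+ w. M_fun 1 a b g (1 / w) / ennreal (\<psi> w) \<partial>lebesgue_on {0<..<b - a})"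
    by (rule W_integral_le[OF gL \<psi> \<psi>_pos])
  also have "\<dots> \<le> 4 * (\<integral>\<^sup>+ w. ennreal c * ennreal (\<phi> (1 / w) / \<psi> w) \<partial>lebesgue_on {0<..<b - a})"
  proof (intro mult_left_mono nn_integral_mono)
    fix w assume "w \<in> space (lebesgue_on {0<..<b - a})"
    then have w: "0 < w" by simp
    have "M_fun 1 a b g (1 / w) / ennreal (\<psi> w) \<le> ennreal c * ennreal (\<phi> (1 / w)) / ennreal (\<psi> w)"
      using M_le[of "1 / w"] w by (intro divide_right_mono_ennreal) simp
    also have "\<dots> = ennreal c * ennreal (\<phi> (1 / w) / \<psi> w)"
      using w \<psi>_pos[OF w] \<phi>[of "1 / w"] by (simp add: divide_ennreal flip: ennreal_times_divide)
    finally show "M_fun 1 a b g (1 / w) / ennreal (\<psi> w) \<le> ennreal c * ennreal (\<phi> (1 / w) / \<psi> w)" .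
  qed simp
  also have "\<dots> = 4 * (ennreal c * (\<integral>\<^sup>+ w. ennreal (\<phi> (1 / w) / \<psi> w) \<partial>lebesgue_on {0<..<b - a}))"
    by (subst nn_integral_cmult[OF meas]) simp
  also have "\<dots> < \<infinity>"
    using fin by (simp add: ennreal_mult_less_top)
  finally show ?thesis
    using gL by (simp add: W_space_def)
qed

end

theorem theorem5p4:
  fixes a b :: real and \<phi> :: "real \<Rightarrow> real"
  assumes ab: "a < b"
    and \<phi>_ge: "\<And>lam. lam > 0 \<Longrightarrow> \<phi> lam \<ge> 1"
    and \<phi>_mono: "mono_on {0<..} \<phi>"
  shows
    "(\<forall>k\<ge>2. S_class k \<phi> a b = S_class 2 \<phi> a b) \<and>
     (S_class 1 \<phi> a b \<subseteq> S_class 2 \<phi> a b \<and> S_class 2 \<phi> a b \<subseteq> S_class 1 (hat \<phi>) a b) \<and>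
     (\<forall>g\<in>L1 a b. \<forall>\<psi>\<in>borel_measurable (lebesgue_on {0<..}). (\<forall>w>0. \<psi> w > 0) \<longrightarrow>
        W_integral \<psi> a b g
          \<le> 4 * (\<integral>\<^sup>+ w. M_fun 1 a b g (1 / w) / ennreal (\<psi> w) \<partial>lebesgue_on {0<..<b - a})) \<and>
     (\<forall>g\<in>S_class 1 \<phi> a b. \<forall>\<psi>\<in>borel_measurable (lebesgue_on {0<..}). (\<forall>w>0. \<psi> w > 0) \<longrightarrow>
        (\<integral>\<^sup>+ w. ennreal (\<phi> (1 / w) / \<psi> w) \<partial>lebesgue_on {0<..<b - a}) < \<infinity> \<longrightarrow>
        g \<in> W_space \<psi> a b)"
proof -
  interpret compact_interval a b by unfold_locales (rule ab)
  show ?thesis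
  proof (intro conjI allI ballI impI)
    show "S_class k \<phi> a b = S_class 2 \<phi> a b" if "2 \<le> k" for k
      by (rule S_class_eq_S_class_2[OF \<phi>_ge \<phi>_mono that])
    show "S_class 1 \<phi> a b \<subseteq> S_class 2 \<phi> a b"
      using S_class_Suc[OF \<phi>_ge \<phi>_mono, of 1] by (simp add: numeral_2_eq_2)
    show "S_class 2 \<phi> a b \<subseteq> S_class 1 (hat \<phi>) a b"
      by (rule S_class_2_subset_hat[OF \<phi>_ge \<phi>_mono])
  qed (use W_integral_le S_class_1_subset_W_space[OF _ \<phi>_ge \<phi>_mono] in auto)
qed

end
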